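(* There exists a family $(P_d)_{d\in\mathbb N}$ of polytopes with $P_d\subset\mathbb R^{2d}$ such that $$\frac{\mathrm{xc}_{\mathrm{PSD}}(P_d)}{\mathrm{xc}_{\mathrm{LP}}(P_d)}=O\left(\frac{\log d}{d}\right)\qquad(d\to\infty).$$
   Context: For a polytope $P\subset\mathbb R^m$: $P$ has an LP lift of size $k$ if $P=\pi(\mathbb R^k_+\cap L)$ for some linear $\pi:\mathbb R^k\to\mathbb R^m$ and affine subspace $L\subset\mathbb R^k$; $\mathrm{xc}_{\mathrm{LP}}(P)$ is the smallest such $k$. $P$ has a Hermitian PSD lift of size $k$ if $P=\pi(\mathbf H^k_+\cap L)$ for some real-linear $\pi:\mathbf H^k\to\mathbb R^m$ and real affine subspace $L\subset\mathbf H^k$, where $\mathbf H^k$ is the real vector space of $k\times k$ complex Hermitian matrices and $\mathbf H^k_+$ its cone of positive semidefinite matrices; $\mathrm{xc}_{\mathrm{PSD}}(P)$ is the smallest such $k$. *)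

theory Defs
  imports
    Complex_Main
    "HOL-Library.Landau_Symbols"
    "Jordan_Normal_Form.Schur_Decomposition"
begin

(* The dimensions of the ambient space and of the lift both vary, so R^m is the
   carrier set carrier_vec m of real vectors, and k x k complex matrices are
   carrier_mat k k. *)

definition convex_hull_vec :: "nat \<Rightarrow> real vec set \<Rightarrow> real vec set" where
  "convex_hull_vec m V =
     {vec m (\<lambda>i. \<Sum>v\<in>V. c v * v $ i) | c. (\<forall>v\<in>V. 0 \<le> c v) \<and> (\<Sum>v\<in>V. c v) = 1}"

definition polytope_vec :: "nat \<Rightarrow> real vec set \<Rightarrow> bool" where
  "polytope_vec m P \<longleftrightarrow> (\<exists>V. finite V \<and> V \<subseteq> carrier_vec m \<and> P = convex_hull_vec m V)"

definition nonneg_orthant :: "nat \<Rightarrow> real vec set" where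
  "nonneg_orthant k = {x \<in> carrier_vec k. \<forall>i<k. 0 \<le> x $ i}"

definition hermitian_mats :: "nat \<Rightarrow> complex mat set" where
  "hermitian_mats k = {A \<in> carrier_mat k k. mat_adjoint A = A}"

definition psd_cone :: "nat \<Rightarrow> complex mat set" where
  "psd_cone k = {A \<in> hermitian_mats k. \<forall>v \<in> carrier_vec k. 0 \<le> Re ((A *\<^sub>v v) \<bullet>c v)}"

abbreviation real_smult_mat :: "real \<Rightarrow> complex mat \<Rightarrow> complex mat" where
  "real_smult_mat c A \<equiv> complex_of_real c \<cdot>\<^sub>m A"

(* In the next three definitions, vadd and vscale are the operations of a real
   vector space with carrier E. As for the library predicate affine, the empty
   set counts as an affine subspace. *)

definition affine_subspace ::
  "('v \<Rightarrow> 'v \<Rightarrow> 'v) \<Rightarrow> (real \<Rightarrow> 'v \<Rightarrow> 'v) \<Rightarrow> 'v set \<Rightarrow> 'v set \<Rightarrow> bool" where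
  "affine_subspace vadd vscale E L \<longleftrightarrow>
     L \<subseteq> E \<and> (\<forall>x\<in>L. \<forall>y\<in>L. \<forall>s t. s + t = 1 \<longrightarrow> vadd (vscale s x) (vscale t y) \<in> L)"

definition real_linear_map ::
  "('v \<Rightarrow> 'v \<Rightarrow> 'v) \<Rightarrow> (real \<Rightarrow> 'v \<Rightarrow> 'v) \<Rightarrow> 'v set \<Rightarrow> nat \<Rightarrow> ('v \<Rightarrow> real vec) \<Rightarrow> bool" where
  "real_linear_map vadd vscale E m f \<longleftrightarrow>
     f \<in> E \<rightarrow> carrier_vec m \<and>
     (\<forall>x\<in>E. \<forall>y\<in>E. f (vadd x y) = f x + f y) \<and>
     (\<forall>c. \<forall>x\<in>E. f (vscale c x) = c \<cdot>\<^sub>v f x)"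

definition has_cone_lift ::
  "('v \<Rightarrow> 'v \<Rightarrow> 'v) \<Rightarrow> (real \<Rightarrow> 'v \<Rightarrow> 'v) \<Rightarrow> 'v set \<Rightarrow> 'v set \<Rightarrow> nat \<Rightarrow> real vec set \<Rightarrow> bool" where
  "has_cone_lift vadd vscale E K m P \<longleftrightarrow>
     (\<exists>f L. real_linear_map vadd vscale E m f \<and> affine_subspace vadd vscale E L \<and> P = f ` (K \<inter> L))"

definition has_lp_lift :: "nat \<Rightarrow> real vec set \<Rightarrow> nat \<Rightarrow> bool" where
  "has_lp_lift m P k \<longleftrightarrow> has_cone_lift (+) (\<cdot>\<^sub>v) (carrier_vec k) (nonneg_orthant k) m P"

definition has_psd_lift :: "nat \<Rightarrow> real vec set \<Rightarrow> nat \<Rightarrow> bool" where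
  "has_psd_lift m P k \<longleftrightarrow> has_cone_lift (+) real_smult_mat (hermitian_mats k) (psd_cone k) m P"

(* Sizes of lifts are positive integers. Admitting size 0 would affect only the
   polytopes {} and {0}: both quantities would vanish, and the ratio xc_psd / xc_lp
   would be the junk value 0 / 0 = 0. *)

definition xc_lp :: "nat \<Rightarrow> real vec set \<Rightarrow> nat" where
  "xc_lp m P = (LEAST k. 0 < k \<and> has_lp_lift m P k)"

definition xc_psd :: "nat \<Rightarrow> real vec set \<Rightarrow> nat" where
  "xc_psd m P = (LEAST k. 0 < k \<and> has_psd_lift m P k)"

end

theory Submission
  imports Defs
begin

text \<open>
  \<open>P\<^sub>d\<close> is the trigonometric cyclic polytope: the convex hull of the points
  \<open>(z, z^2, \<dots>, z^d)\<close>, where \<open>z\<close> runs through the \<open>N\<close>-th roots of unity and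
  \<open>N = d 2^n\<close> with \<open>d \<le> 2^n < 2 d\<close>.

  Its PSD lift consists of the positive semidefinite matrices \<open>(y (s - t))\<close> with \<open>s\<close>, \<open>t\<close> in the
  set of frequencies made of the blocks of length \<open>d\<close> starting at \<open>0, d, 2d, 4d, \<dots>, 2^n d\<close>. The
  cycle \<open>\<int>/N\<int>\<close> of \<open>2^n\<close> blocks is triangulated by triangles of the form
  \<open>(j, j + 2^i, j + 2^(i+1))\<close>, and all translates of such a triangle carry the same matrix, so
  chordal completion yields a positive semidefinite kernel on \<open>\<int>/N\<int>\<close> that equals \<open>y (s - t)\<close>
  whenever \<open>s\<close> and \<open>t\<close> are at distance at most \<open>d\<close>. Its quadratic form at the characters gives
  a probability measure on the roots of unity with moments \<open>y 1, \<dots>, y d\<close>.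

  For the lower bound, \<open>\<Prod>\<^sub>w |z - w|^2\<close> shows that any at most \<open>d\<close> vertices are the vertex set of
  a face. Hence the support of an orthant lift of a vertex is never covered by the supports of
  the lifts of \<open>d\<close> others, and a \<open>d\<close>-cover-free family of \<open>N \<ge> d^2\<close> sets needs at least
  \<open>d^2/2\<close> points.
\<close>

section \<open>Positive semidefinite kernels\<close>

definition herm_form :: "'a set \<Rightarrow> ('a \<Rightarrow> 'a \<Rightarrow> complex) \<Rightarrow> ('a \<Rightarrow> complex) \<Rightarrow> ('a \<Rightarrow> complex) \<Rightarrow> complex" where
  "herm_form S X f g = (\<Sum>s\<in>S. \<Sum>t\<in>S. cnj (f s) * X s t * g t)"

text \<open>Kernels on arbitrary index sets replace matrices, so that sets of frequencies can be
  restricted, translated and united without renumbering rows.\<close>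

definition psd_kernel :: "'a set \<Rightarrow> ('a \<Rightarrow> 'a \<Rightarrow> complex) \<Rightarrow> bool" where
  "psd_kernel S X \<longleftrightarrow> (\<forall>s\<in>S. \<forall>t\<in>S. X t s = cnj (X s t)) \<and> (\<forall>f. 0 \<le> Re (herm_form S X f f))"

lemma psd_kernel_sym: "psd_kernel S X \<Longrightarrow> s \<in> S \<Longrightarrow> t \<in> S \<Longrightarrow> X t s = cnj (X s t)"
  unfolding psd_kernel_def by blast

lemma psd_kernel_nonneg: "psd_kernel S X \<Longrightarrow> 0 \<le> Re (herm_form S X f f)"
  unfolding psd_kernel_def by blast

lemma herm_form_cong:
  "(\<And>s t. s \<in> S \<Longrightarrow> t \<in> S \<Longrightarrow> X s t = Y s t) \<Longrightarrow> herm_form S X f g = herm_form S Y f g"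
  unfolding herm_form_def by (intro sum.cong) auto

lemma psd_kernel_cong:
  assumes "psd_kernel S X" "\<And>s t. s \<in> S \<Longrightarrow> t \<in> S \<Longrightarrow> X s t = Y s t"
  shows "psd_kernel S Y"
proof -
  have "0 \<le> Re (herm_form S Y f f)" for f
    using psd_kernel_nonneg[OF assms(1), of f] herm_form_cong[of S X Y f f] assms(2) by simp
  moreover have "Y t s = cnj (Y s t)" if "s \<in> S" "t \<in> S" for s t
    unfolding assms(2)[OF that, symmetric] assms(2)[OF that(2,1), symmetric]
    by (rule psd_kernel_sym[OF assms(1) that])
  ultimately show ?thesis
    unfolding psd_kernel_def by blast
qed

lemma herm_form_add_left: "herm_form S X (\<lambda>s. f s + f' s) g = herm_form S X f g + herm_form S X f' g"
  unfolding herm_form_def by (simp add: sum.distrib algebra_simps)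

lemma herm_form_add_right: "herm_form S X f (\<lambda>s. g s + g' s) = herm_form S X f g + herm_form S X f g'"
  unfolding herm_form_def by (simp add: sum.distrib algebra_simps)

lemma herm_form_scale_left: "herm_form S X (\<lambda>s. a * f s) g = cnj a * herm_form S X f g"
  unfolding herm_form_def by (simp add: sum_distrib_left mult_ac)

lemma herm_form_scale_right: "herm_form S X f (\<lambda>s. a * g s) = a * herm_form S X f g"
  unfolding herm_form_def by (simp add: sum_distrib_left mult_ac)

lemma herm_form_sym:
  assumes "psd_kernel S X"
  shows "herm_form S X g f = cnj (herm_form S X f g)"
proof -
  have "cnj (herm_form S X f g) = (\<Sum>s\<in>S. \<Sum>t\<in>S. f s * X t s * cnj (g t))"
    unfolding herm_form_def cnj_sum
  proof (intro sum.cong refl)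
    fix s t assume "s \<in> S" "t \<in> S"
    then show "cnj (cnj (f s) * X s t * g t) = f s * X t s * cnj (g t)"
      using psd_kernel_sym[OF assms, of s t] by simp
  qed
  also have "\<dots> = herm_form S X g f"
    unfolding herm_form_def by (subst sum.swap) (intro sum.cong refl, simp)
  finally show ?thesis ..
qed

lemma herm_form_delta_left:
  assumes "finite S" "u \<in> S"
  shows "herm_form S X (\<lambda>s. if s = u then 1 else 0) g = (\<Sum>t\<in>S. X u t * g t)"
proof -
  have "herm_form S X (\<lambda>s. if s = u then 1 else 0) g = (\<Sum>s\<in>S. if s = u then \<Sum>t\<in>S. X s t * g t else 0)"
    unfolding herm_form_def by (intro sum.cong) auto
  then show ?thesis using assms by simp
qed

text \<open>The degenerate case of Cauchy-Schwarz: adding \<open>a * w\<close> to \<open>g\<close>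
  changes the form only by a term linear in \<open>a\<close>, which would become arbitrarily
  negative if the mixed term were nonzero.\<close>

lemma herm_form_null:
  assumes "psd_kernel S X" "Re (herm_form S X w w) = 0"
  shows "herm_form S X g w = 0"
proof (rule ccontr)
  define q where "q = herm_form S X g w"
  assume "herm_form S X g w \<noteq> 0"
  then have q: "norm q > 0" by (simp add: q_def)
  define r where "r = Re (herm_form S X g g)"
  have key: "0 \<le> r + 2 * Re (a * q)" for a
  proof -
    have "0 \<le> Re (herm_form S X (\<lambda>s. g s + a * w s) (\<lambda>s. g s + a * w s))"
      by (rule psd_kernel_nonneg[OF assms(1)])
    also have "herm_form S X (\<lambda>s. g s + a * w s) (\<lambda>s. g s + a * w s) =
       herm_form S X g g + a * q + cnj a * (cnj q + a * herm_form S X w w)"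
      using herm_form_sym[OF assms(1), of w g]
      by (simp add: herm_form_add_left herm_form_add_right herm_form_scale_left
          herm_form_scale_right q_def algebra_simps)
    also have "cnj a * (cnj q + a * herm_form S X w w) = cnj (a * q) + of_real ((norm a)\<^sup>2) * herm_form S X w w"
      by (simp add: algebra_simps complex_norm_square flip: of_real_power)
    also have "Re (herm_form S X g g + a * q + (cnj (a * q) + of_real ((norm a)\<^sup>2) * herm_form S X w w)) = r + 2 * Re (a * q)"
      using assms(2) by (simp add: r_def)
    finally show ?thesis .
  qed
  have "0 \<le> r" by (simp add: r_def psd_kernel_nonneg[OF assms(1)])
  \<comment> \<open>This multiplier of \<open>w\<close> turns \<open>r + 2 * Re (a * q)\<close> into
    \<open>- r - 2\<close>, which is negative.\<close>
  have "Re (- of_real ((r + 1) / (norm q)\<^sup>2) * cnj q * q) = - (r + 1)"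
  proof -
    have "- of_real ((r + 1) / (norm q)\<^sup>2) * cnj q * q = - of_real ((r + 1) / (norm q)\<^sup>2) * of_real ((norm q)\<^sup>2)"
      by (simp add: complex_norm_square mult_ac flip: of_real_power)
    then show ?thesis using q by simp
  qed
  with key[of "- of_real ((r + 1) / (norm q)\<^sup>2) * cnj q"] \<open>0 \<le> r\<close> show False by linarith
qed

text \<open>A congruence by the matrix \<open>P\<close>: the new form at \<open>f\<close> is the
  form of \<open>X\<close> at \<open>P f\<close>. Reindexing and padding by zeros are the instances
  where \<open>P\<close> consists of unit vectors.\<close>

lemma psd_kernel_comp:
  assumes "psd_kernel S X" "finite S"
  shows "psd_kernel U (\<lambda>u v. \<Sum>s\<in>S. \<Sum>t\<in>S. cnj (P s u) * X s t * P t v)"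
  unfolding psd_kernel_def
proof (intro conjI ballI allI)
  fix u v
  show "(\<Sum>s\<in>S. \<Sum>t\<in>S. cnj (P s v) * X s t * P t u) = cnj (\<Sum>s\<in>S. \<Sum>t\<in>S. cnj (P s u) * X s t * P t v)"
    using herm_form_sym[OF assms(1), of "\<lambda>s. P s v" "\<lambda>s. P s u"] unfolding herm_form_def .
next
  fix f
  have "herm_form U (\<lambda>u v. \<Sum>s\<in>S. \<Sum>t\<in>S. cnj (P s u) * X s t * P t v) f f
     = (\<Sum>u\<in>U. \<Sum>v\<in>U. \<Sum>s\<in>S. \<Sum>t\<in>S. cnj (P s u * f u) * X s t * (P t v * f v))"
    unfolding herm_form_def by (simp add: sum_distrib_left sum_distrib_right mult_ac)
  also have "\<dots> = (\<Sum>u\<in>U. \<Sum>s\<in>S. \<Sum>v\<in>U. \<Sum>t\<in>S. cnj (P s u * f u) * X s t * (P t v * f v))"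
    by (intro sum.cong refl sum.swap)
  also have "\<dots> = (\<Sum>s\<in>S. \<Sum>u\<in>U. \<Sum>v\<in>U. \<Sum>t\<in>S. cnj (P s u * f u) * X s t * (P t v * f v))"
    by (rule sum.swap)
  also have "\<dots> = (\<Sum>s\<in>S. \<Sum>u\<in>U. \<Sum>t\<in>S. \<Sum>v\<in>U. cnj (P s u * f u) * X s t * (P t v * f v))"
    by (intro sum.cong refl sum.swap)
  also have "\<dots> = (\<Sum>s\<in>S. \<Sum>t\<in>S. \<Sum>u\<in>U. \<Sum>v\<in>U. cnj (P s u * f u) * X s t * (P t v * f v))"
    by (intro sum.cong refl sum.swap)
  also have "\<dots> = herm_form S X (\<lambda>s. \<Sum>u\<in>U. P s u * f u) (\<lambda>s. \<Sum>u\<in>U. P s u * f u)"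
    unfolding herm_form_def by (simp add: sum_distrib_left sum_distrib_right mult_ac)
  finally show "0 \<le> Re (herm_form U (\<lambda>u v. \<Sum>s\<in>S. \<Sum>t\<in>S. cnj (P s u) * X s t * P t v) f f)"
    using psd_kernel_nonneg[OF assms(1)] by simp
qed

lemma psd_kernel_add:
  assumes "psd_kernel S X" "psd_kernel S Y"
  shows "psd_kernel S (\<lambda>s t. X s t + Y s t)"
proof -
  have "herm_form S (\<lambda>s t. X s t + Y s t) f f = herm_form S X f f + herm_form S Y f f" for f
    unfolding herm_form_def by (simp add: sum.distrib algebra_simps)
  then have "0 \<le> Re (herm_form S (\<lambda>s t. X s t + Y s t) f f)" for f
    using psd_kernel_nonneg[OF assms(1), of f] psd_kernel_nonneg[OF assms(2), of f] by simp
  moreover have "X t s + Y t s = cnj (X s t + Y s t)" if "s \<in> S" "t \<in> S" for s t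
    unfolding psd_kernel_sym[OF assms(1) that] psd_kernel_sym[OF assms(2) that] by simp
  ultimately show ?thesis unfolding psd_kernel_def by blast
qed

lemma psd_kernel_map:
  assumes "psd_kernel S X" "finite S" "g ` U \<subseteq> S"
  shows "psd_kernel U (\<lambda>u v. X (g u) (g v))"
proof (rule psd_kernel_cong[OF psd_kernel_comp[OF assms(1,2), of U "\<lambda>s u. if s = g u then 1 else 0"]])
  fix u v assume "u \<in> U" "v \<in> U"
  then have "g u \<in> S" "g v \<in> S" using assms(3) by auto
  then show "(\<Sum>s\<in>S. \<Sum>t\<in>S. cnj (if s = g u then 1 else 0) * X s t * (if t = g v then 1 else 0)) = X (g u) (g v)"
    using herm_form_delta_left[OF assms(2), of "g u" X "\<lambda>s. if s = g v then 1 else 0"] assms(2)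
    unfolding herm_form_def by (simp add: if_distrib[of "\<lambda>x. _ * x"] sum.delta cong: if_cong)
qed

lemma psd_kernel_mono: "psd_kernel S X \<Longrightarrow> finite S \<Longrightarrow> U \<subseteq> S \<Longrightarrow> psd_kernel U X"
  using psd_kernel_map[of S X "\<lambda>u. u" U] by simp

lemma psd_kernel_extend_zero:
  assumes "psd_kernel T Y" "finite U" "T \<subseteq> U"
  shows "psd_kernel U (\<lambda>u v. if u \<in> T \<and> v \<in> T then Y u v else 0)"
proof -
  have fT: "finite T" using assms finite_subset by blast
  show ?thesis
  proof (rule psd_kernel_cong[OF psd_kernel_comp[OF assms(1) fT, of U "\<lambda>s u. if s = u then 1 else 0"]])
    fix u v
    show "(\<Sum>s\<in>T. \<Sum>t\<in>T. cnj (if s = u then 1 else 0) * Y s t * (if t = v then 1 else 0)) = (if u \<in> T \<and> v \<in> T then Y u v else 0)"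
      using herm_form_delta_left[OF fT, of u Y "\<lambda>s. if s = v then 1 else 0"] fT
      unfolding herm_form_def
      by (cases "u \<in> T") (auto simp: if_distrib[of "\<lambda>x. _ * x"] sum.delta intro!: sum.neutral cong: if_cong)
  qed
qed

section \<open>Projection, gluing and completion of kernels\<close>

text \<open>Reading \<open>X\<close> as a Gram matrix, \<open>k\<close> holds the coefficients of the orthogonal projection of
  the vector \<open>t\<close> onto the span of \<open>C\<close>; the induction is Gram--Schmidt.\<close>

lemma psd_kernel_projection:
  assumes psd: "psd_kernel S X" and fin: "finite S" and "C \<subseteq> S" and "t \<in> S"
  shows "\<exists>k. \<forall>s\<in>C. X s t = (\<Sum>c\<in>C. X s c * k c)"
proof -
  have "finite C" using fin \<open>C \<subseteq> S\<close> finite_subset by blast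
  then show ?thesis using \<open>C \<subseteq> S\<close> \<open>t \<in> S\<close>
  proof (induction C arbitrary: t rule: finite_induct)
    case empty
    then show ?case by simp
  next
    case (insert a C)
    then have CS: "C \<subseteq> S" and aS: "a \<in> S" and tS: "t \<in> S" by auto
    obtain ka where ka: "\<And>s. s \<in> C \<Longrightarrow> X s a = (\<Sum>c\<in>C. X s c * ka c)"
      using insert.IH[OF CS aS] by blast
    obtain kt where kt: "\<And>s. s \<in> C \<Longrightarrow> X s t = (\<Sum>c\<in>C. X s c * kt c)"
      using insert.IH[OF CS tS] by blast
    \<comment> \<open>In the Gram picture, \<open>r\<close> is the squared length of the residual of
      \<open>a\<close> over \<open>C\<close>, and \<rho> is the inner product of \<open>a\<close>
      with the residual of \<open>t\<close>.\<close>
    define r where "r = X a a - (\<Sum>c\<in>C. X a c * ka c)"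
    define \<rho> where "\<rho> = X a t - (\<Sum>c\<in>C. X a c * kt c)"
    \<comment> \<open>If \<open>r = 0\<close>, the residual \<open>w\<close> of \<open>a\<close> is
      a null vector, so it is orthogonal to \<open>t\<close>, although \<open>t\<close> itself need
      not be in the span of \<open>C\<close>.\<close>
    have r0: "\<rho> = 0" if "r = 0"
    proof -
      define w where "w s = (if s = a then 1 else if s \<in> C then - ka s else 0)" for s
      have apply_w: "(\<Sum>s\<in>S. X u s * w s) = X u a - (\<Sum>c\<in>C. X u c * ka c)" for u
      proof -
        have "(\<Sum>s\<in>S. X u s * w s) = (\<Sum>s\<in>insert a C. X u s * w s)"
          using fin CS aS by (intro sum.mono_neutral_right) (auto simp: w_def)
        also have "\<dots> = X u a + (\<Sum>s\<in>C. X u s * w s)"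
          using insert.hyps by (simp add: w_def)
        also have "(\<Sum>s\<in>C. X u s * w s) = (\<Sum>c\<in>C. - (X u c * ka c))"
          using insert.hyps by (intro sum.cong) (auto simp: w_def)
        finally show ?thesis by (simp add: sum_negf)
      qed
      have "herm_form S X w w = (\<Sum>s\<in>S. cnj (w s) * (\<Sum>u\<in>S. X s u * w u))"
        unfolding herm_form_def by (simp add: sum_distrib_left mult_ac)
      also have "\<dots> = 0"
      proof (intro sum.neutral ballI)
        fix s
        have "X s a - (\<Sum>c\<in>C. X s c * ka c) = 0" if "w s \<noteq> 0"
          using that ka[of s] \<open>r = 0\<close> unfolding r_def w_def by (auto split: if_splits)
        then show "cnj (w s) * (\<Sum>u\<in>S. X s u * w u) = 0"
          unfolding apply_w by (cases "w s = 0") auto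
      qed
      finally have "herm_form S X (\<lambda>s. if s = t then 1 else 0) w = 0"
        by (intro herm_form_null[OF psd]) simp
      then have "X t a = (\<Sum>c\<in>C. X t c * ka c)"
        using herm_form_delta_left[OF fin tS, of X w] apply_w by simp
      \<comment> \<open>Expand \<open>X c t\<close> by \<open>kt\<close> and exchange the sums: the
        inner sum over \<open>c\<close> is then the expansion of \<open>X e a\<close> by
        \<open>ka\<close>, conjugated.\<close>
      then have "X a t = (\<Sum>c\<in>C. cnj (X t c * ka c))"
        using psd_kernel_sym[OF psd tS aS] by simp
      also have "\<dots> = (\<Sum>c\<in>C. X c t * cnj (ka c))"
        using psd_kernel_sym[OF psd tS] CS by (intro sum.cong) auto
      also have "\<dots> = (\<Sum>c\<in>C. \<Sum>e\<in>C. X c e * kt e * cnj (ka c))"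
        by (intro sum.cong refl, subst kt) (simp_all add: sum_distrib_right)
      also have "\<dots> = (\<Sum>e\<in>C. \<Sum>c\<in>C. X c e * kt e * cnj (ka c))"
        by (rule sum.swap)
      also have "\<dots> = (\<Sum>e\<in>C. cnj (\<Sum>c\<in>C. X e c * ka c) * kt e)"
      proof (intro sum.cong refl)
        fix e assume "e \<in> C"
        then have "X c e = cnj (X e c)" if "c \<in> C" for c
          using psd_kernel_sym[OF psd] CS that by blast
        then show "(\<Sum>c\<in>C. X c e * kt e * cnj (ka c)) = cnj (\<Sum>c\<in>C. X e c * ka c) * kt e"
          by (simp add: sum_distrib_left mult_ac)
      qed
      also have "\<dots> = (\<Sum>e\<in>C. X a e * kt e)"
      proof (intro sum.cong refl)
        fix e assume e: "e \<in> C"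
        then show "cnj (\<Sum>c\<in>C. X e c * ka c) * kt e = X a e * kt e"
          unfolding ka[OF e, symmetric] using psd_kernel_sym[OF psd _ aS, of e] CS by auto
      qed
      finally show ?thesis by (simp add: \<rho>_def)
    qed
    \<comment> \<open>The coefficient of \<open>t\<close> along the residual of \<open>a\<close>.
      For \<open>r = 0\<close> the division yields \<open>l = 0\<close>, and
      \<open>l * r = \<rho>\<close> survives by \<open>r0\<close>.\<close>
    define l where "l = \<rho> / r"
    have l: "l * r = \<rho>" using r0 by (cases "r = 0") (auto simp: l_def)
    define k where "k c = (if c = a then l else kt c - l * ka c)" for c
    have k_sum: "(\<Sum>c\<in>insert a C. X s c * k c) = l * (X s a - (\<Sum>c\<in>C. X s c * ka c)) + (\<Sum>c\<in>C. X s c * kt c)" for s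
    proof -
      have "(\<Sum>c\<in>insert a C. X s c * k c) = X s a * l + (\<Sum>c\<in>C. X s c * k c)"
        using insert.hyps by (simp add: k_def)
      also have "(\<Sum>c\<in>C. X s c * k c) = (\<Sum>c\<in>C. X s c * kt c - l * (X s c * ka c))"
        using insert.hyps by (intro sum.cong) (auto simp: k_def algebra_simps)
      finally show ?thesis by (simp add: sum_subtractf sum_distrib_left algebra_simps)
    qed
    have "X s t = (\<Sum>c\<in>insert a C. X s c * k c)" if "s \<in> insert a C" for s
    proof (cases "s = a")
      case True
      then show ?thesis using l unfolding k_sum r_def[symmetric] True by (simp add: \<rho>_def)
    next
      case False
      with that have "s \<in> C" by blast
      then show ?thesis unfolding k_sum ka[OF \<open>s \<in> C\<close>, symmetric] kt[OF \<open>s \<in> C\<close>, symmetric] by simp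
    qed
    then show ?case by (intro exI[of _ k] ballI)
  qed
qed

text \<open>Positive semidefinite completion for two cliques: project the vectors of \<open>T\<close> onto
  \<open>S \<inter> T\<close>, transport the projections to the Gram representation of \<open>X\<close>, and put the
  remainders (kernel \<open>R\<close>) into a fresh orthogonal summand.\<close>

lemma psd_kernel_glue:
  assumes X: "psd_kernel S X" and Y: "psd_kernel T Y" and fS: "finite S" and fT: "finite T"
    and agree: "\<And>s t. s \<in> S \<inter> T \<Longrightarrow> t \<in> S \<inter> T \<Longrightarrow> X s t = Y s t"
  obtains Z where "psd_kernel (S \<union> T) Z"
    and "\<And>s t. s \<in> S \<Longrightarrow> t \<in> S \<Longrightarrow> Z s t = X s t"
    and "\<And>s t. s \<in> T \<Longrightarrow> t \<in> T \<Longrightarrow> Z s t = Y s t"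
proof -
  define C where "C = S \<inter> T"
  have C: "C \<subseteq> S" "C \<subseteq> T" "finite C" using fS by (auto simp: C_def)
  have "\<forall>t\<in>T. \<exists>k. \<forall>s\<in>C. Y s t = (\<Sum>c\<in>C. Y s c * k c)"
    using psd_kernel_projection[OF Y fT C(2)] by blast
  then obtain k where k: "\<And>s t. s \<in> C \<Longrightarrow> t \<in> T \<Longrightarrow> Y s t = (\<Sum>c\<in>C. Y s c * k t c)"
    by metis
  \<comment> \<open>Column \<open>t\<close> of \<open>p\<close> is the unit vector at
    \<open>t\<close> for \<open>t\<close> in \<open>S\<close>, and the projection of
    \<open>t\<close> onto \<open>C\<close> for the remaining \<open>t\<close>.\<close>
  define p where "p c t = (if t \<in> S then if c = t then 1 else 0 else if c \<in> C then k t c else 0)" for c t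
  have p_out: "p c t = 0" if "t \<in> T" "c \<notin> C" for c t
    using that by (auto simp: p_def C_def)
  have p: "(\<Sum>c\<in>C. Y s c * p c t) = Y s t" if "s \<in> C" "t \<in> T" for s t
  proof (cases "t \<in> S")
    case True
    with that show ?thesis using C
      by (simp add: p_def C_def if_distrib[of "\<lambda>x. _ * x"] sum.delta cong: if_cong)
  next
    case False
    then show ?thesis using k[OF that] by (simp add: p_def)
  qed
  define XP where "XP u v = (\<Sum>s\<in>S. \<Sum>t\<in>S. cnj (p s u) * X s t * p t v)" for u v
  define Q where "Q u v = (\<Sum>s\<in>C. \<Sum>t\<in>C. cnj (p s u) * Y s t * p t v)" for u v
  define \<rho> where "\<rho> s u = (if s = u then 1 else 0) + (-1) * p s u" for s u
  define R where "R u v = (\<Sum>s\<in>T. \<Sum>t\<in>T. cnj (\<rho> s u) * Y s t * \<rho> t v)" for u v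
  \<comment> \<open>For indices in \<open>T\<close> the columns of \<open>p\<close> are supported in
    \<open>C\<close>, where \<open>X\<close> and \<open>Y\<close> agree.\<close>
  have XPQ: "XP u v = Q u v" if "u \<in> T" "v \<in> T" for u v
  proof -
    have "XP u v = (\<Sum>s\<in>C. \<Sum>t\<in>S. cnj (p s u) * X s t * p t v)"
      unfolding XP_def using fS C p_out that by (intro sum.mono_neutral_right) auto
    also have "\<dots> = (\<Sum>s\<in>C. \<Sum>t\<in>C. cnj (p s u) * X s t * p t v)"
      using fS C p_out that by (intro sum.cong refl sum.mono_neutral_right) auto
    finally show ?thesis using agree unfolding Q_def C_def by simp
  qed
  have XPX: "XP u v = X u v" if "u \<in> S" "v \<in> S" for u v
    using that herm_form_delta_left[OF fS, of u X "\<lambda>s. if s = v then 1 else 0"] fS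
    unfolding XP_def p_def herm_form_def
    by (simp add: if_distrib[of "\<lambda>x. _ * x"] sum.delta cong: if_cong)
  have QY: "(\<Sum>s\<in>C. cnj (p s u) * Y s v) = Q u v" if "v \<in> T" for u v
  proof -
    have "(\<Sum>s\<in>C. cnj (p s u) * Y s v) = (\<Sum>s\<in>C. cnj (p s u) * (\<Sum>t\<in>C. Y s t * p t v))"
      using p that by (intro sum.cong) auto
    then show ?thesis unfolding Q_def by (simp add: sum_distrib_left mult_ac)
  qed
  let ?h = "herm_form T Y" and ?p = "\<lambda>u s. p s u" and ?d = "\<lambda>u s. if s = u then 1 else 0 :: complex"
  have hp: "?h (?p u) g = (\<Sum>s\<in>C. cnj (p s u) * (\<Sum>t\<in>T. Y s t * g t))" if "u \<in> T" for u g
  proof -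
    have "?h (?p u) g = (\<Sum>s\<in>T. cnj (p s u) * (\<Sum>t\<in>T. Y s t * g t))"
      unfolding herm_form_def by (simp add: sum_distrib_left mult_ac)
    also have "\<dots> = (\<Sum>s\<in>C. cnj (p s u) * (\<Sum>t\<in>T. Y s t * g t))"
      using fT C p_out that by (intro sum.mono_neutral_right) auto
    finally show ?thesis .
  qed
  have hpd: "?h (?p u) (?d v) = Q u v" if "u \<in> T" "v \<in> T" for u v
    using that fT QY by (simp add: hp if_distrib[of "\<lambda>x. _ * x"] sum.delta cong: if_cong)
  have hdp: "?h (?d u) (?p v) = Q u v" if "u \<in> T" "v \<in> T" for u v
    using hpd[OF that(2,1)] herm_form_sym[OF Y, of "?d u" "?p v"] XPQ
      psd_kernel_sym[OF psd_kernel_comp[OF X fS, of UNIV p], of v u] that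
    unfolding XP_def by simp
  have hpp: "?h (?p u) (?p v) = Q u v" if "u \<in> T" "v \<in> T" for u v
  proof -
    have "(\<Sum>t\<in>T. Y s t * p t v) = Y s v" if "s \<in> C" for s
    proof -
      have "(\<Sum>t\<in>T. Y s t * p t v) = (\<Sum>t\<in>C. Y s t * p t v)"
        using fT C p_out \<open>v \<in> T\<close> by (intro sum.mono_neutral_right) auto
      then show ?thesis using p[OF that \<open>v \<in> T\<close>] by simp
    qed
    then show ?thesis using QY that by (simp add: hp)
  qed
  have hdd: "?h (?d u) (?d v) = Y u v" if "u \<in> T" "v \<in> T" for u v
    using that fT herm_form_delta_left[OF fT, of u Y "?d v"]
    by (simp add: if_distrib[of "\<lambda>x. _ * x"] sum.delta cong: if_cong)
  \<comment> \<open>Projecting twice changes nothing, so both mixed terms and the projected term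
    equal \<open>Q\<close>; the expansion is \<open>Y - Q - Q + Q\<close>.\<close>
  have RY: "R u v = Y u v - Q u v" if "u \<in> T" "v \<in> T" for u v
  proof -
    have "R u v = ?h (\<lambda>s. ?d u s + (-1) * ?p u s) (\<lambda>s. ?d v s + (-1) * ?p v s)"
      unfolding R_def \<rho>_def herm_form_def ..
    also have "\<dots> = Y u v - Q u v"
      unfolding herm_form_add_left herm_form_add_right herm_form_scale_left herm_form_scale_right
      using hpd hdp hpp hdd that by simp
    finally show ?thesis .
  qed
  \<comment> \<open>Points of \<open>S \<inter> T\<close> are their own projections, so adding
    \<open>R\<close> leaves the values on \<open>S\<close> untouched.\<close>
  have R0: "R u v = 0" if "u \<in> S \<inter> T" "v \<in> T" for u v
  proof -
    have "\<rho> s u = 0" for s using that by (simp add: \<rho>_def p_def)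
    then show ?thesis by (simp add: R_def)
  qed
  have R0': "R v u = 0" if "u \<in> S \<inter> T" for u v
  proof -
    have "\<rho> s u = 0" for s using that by (simp add: \<rho>_def p_def)
    then show ?thesis by (simp add: R_def)
  qed
  define Z where "Z u v = XP u v + (if u \<in> T \<and> v \<in> T then R u v else 0)" for u v
  show ?thesis
  proof
    have "psd_kernel T R"
      unfolding R_def using psd_kernel_comp[OF Y fT] by blast
    then have "psd_kernel (S \<union> T) (\<lambda>u v. if u \<in> T \<and> v \<in> T then R u v else 0)"
      using psd_kernel_extend_zero fS fT by blast
    moreover have "psd_kernel (S \<union> T) XP"
      unfolding XP_def using psd_kernel_comp[OF X fS] by blast
    ultimately show "psd_kernel (S \<union> T) Z"
      unfolding Z_def by (intro psd_kernel_add)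
    show "Z s t = X s t" if "s \<in> S" "t \<in> S" for s t
      using that XPX R0 by (auto simp: Z_def)
    show "Z s t = Y s t" if "s \<in> T" "t \<in> T" for s t
      using that XPQ RY by (auto simp: Z_def)
  qed
qed

text \<open>Two translates of a completed interval are glued to the clique \<open>T\<close> formed by their end
  blocks; each meets \<open>T\<close> in two blocks, on which the kernel is already prescribed.\<close>

lemma toeplitz_completion_double:
  fixes d m :: int and y :: "int \<Rightarrow> complex"
  assumes dm: "0 \<le> d" "d \<le> m"
    and X: "psd_kernel {0..<m+d} X"
    and band: "\<And>u v. u \<in> {0..<m+d} \<Longrightarrow> v \<in> {0..<m+d} \<Longrightarrow> \<bar>u - v\<bar> \<le> d \<Longrightarrow> X u v = y (u - v)"
    and ends: "\<And>u v. u \<in> {0..<d} \<union> {m..<m+d} \<Longrightarrow> v \<in> {0..<d} \<union> {m..<m+d} \<Longrightarrow> X u v = y (u - v)"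
    and Y: "psd_kernel ({0..<d} \<union> {m..<m+d} \<union> {2*m..<2*m+d}) (\<lambda>u v. y (u - v))"
  obtains Z where "psd_kernel {0..<2*m+d} Z"
    and "\<And>u v. u \<in> {0..<2*m+d} \<Longrightarrow> v \<in> {0..<2*m+d} \<Longrightarrow> \<bar>u - v\<bar> \<le> d \<Longrightarrow> Z u v = y (u - v)"
    and "\<And>u v. u \<in> {0..<d} \<union> {2*m..<2*m+d} \<Longrightarrow> v \<in> {0..<d} \<union> {2*m..<2*m+d} \<Longrightarrow> Z u v = y (u - v)"
proof -
  define T where "T = {0..<d} \<union> {m..<m+d} \<union> {2*m..<2*m+d}"
  have "{0..<m+d} \<inter> T = {0..<d} \<union> {m..<m+d}"
    using dm by (auto simp: T_def)
  with ends have "\<And>u v. u \<in> {0..<m+d} \<inter> T \<Longrightarrow> v \<in> {0..<m+d} \<inter> T \<Longrightarrow> X u v = y (u - v)"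
    by simp
  then obtain Z1 where Z1: "psd_kernel ({0..<m+d} \<union> T) Z1"
    and Z1X: "\<And>s t. s \<in> {0..<m+d} \<Longrightarrow> t \<in> {0..<m+d} \<Longrightarrow> Z1 s t = X s t"
    and Z1Y: "\<And>s t. s \<in> T \<Longrightarrow> t \<in> T \<Longrightarrow> Z1 s t = y (s - t)"
    using psd_kernel_glue[OF X Y[folded T_def]] by (metis T_def finite_UnI finite_atLeastLessThan_int)
  define X2 where "X2 u v = X (u - m) (v - m)" for u v
  have X2: "psd_kernel {m..<2*m+d} X2"
    unfolding X2_def by (rule psd_kernel_map[OF X]) auto
  \<comment> \<open>The overlap with everything glued so far is again just two blocks:
    \<open>{m..<m+d}\<close> is all that the first interval contributes, and it belongs to
    \<open>T\<close>.\<close>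
  have int2: "({0..<m+d} \<union> T) \<inter> {m..<2*m+d} = {m..<m+d} \<union> {2*m..<2*m+d}"
    using dm by (auto simp: T_def)
  have "Z1 u v = X2 u v" if "u \<in> {m..<m+d} \<union> {2*m..<2*m+d}" "v \<in> {m..<m+d} \<union> {2*m..<2*m+d}" for u v
  proof -
    have "X2 u v = y (u - v)"
      unfolding X2_def using that ends[of "u - m" "v - m"] by auto
    then show ?thesis using that Z1Y by (simp add: T_def)
  qed
  then obtain Z where Z: "psd_kernel (({0..<m+d} \<union> T) \<union> {m..<2*m+d}) Z"
    and ZZ1: "\<And>s t. s \<in> {0..<m+d} \<union> T \<Longrightarrow> t \<in> {0..<m+d} \<union> T \<Longrightarrow> Z s t = Z1 s t"
    and ZX2: "\<And>s t. s \<in> {m..<2*m+d} \<Longrightarrow> t \<in> {m..<2*m+d} \<Longrightarrow> Z s t = X2 s t"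
    using psd_kernel_glue[OF Z1 X2] by (metis T_def finite_UnI finite_atLeastLessThan_int int2)
  show ?thesis
  proof
    have "({0..<m+d} \<union> T) \<union> {m..<2*m+d} = {0..<2*m+d}"
      using dm by (auto simp: T_def)
    with Z show "psd_kernel {0..<2*m+d} Z" by simp
    show "Z u v = y (u - v)" if "u \<in> {0..<d} \<union> {2*m..<2*m+d}" "v \<in> {0..<d} \<union> {2*m..<2*m+d}" for u v
    proof -
      have "u \<in> T" "v \<in> T" using that by (auto simp: T_def)
      then show ?thesis using ZZ1[of u v] Z1Y[of u v] by simp
    qed
    show "Z u v = y (u - v)" if uv: "u \<in> {0..<2*m+d}" "v \<in> {0..<2*m+d}" "\<bar>u - v\<bar> \<le> d" for u v
    proof -
      \<comment> \<open>The two intervals overlap in \<open>d\<close> points, so a pair not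
        contained in one of them is at distance at least \<open>d + 1\<close>.\<close>
      have "u \<in> {0..<m+d} \<and> v \<in> {0..<m+d} \<or> u \<in> {m..<2*m+d} \<and> v \<in> {m..<2*m+d}"
        using uv by auto
      then show ?thesis
      proof
        assume "u \<in> {0..<m+d} \<and> v \<in> {0..<m+d}"
        then show ?thesis using ZZ1[of u v] Z1X[of u v] band[of u v] uv(3) by simp
      next
        assume "u \<in> {m..<2*m+d} \<and> v \<in> {m..<2*m+d}"
        then show ?thesis using ZX2[of u v] band[of "u - m" "v - m"] uv(3) by (simp add: X2_def)
      qed
    qed
  qed
qed

text \<open>Each induction step doubles the distance between the end blocks. The last conjunct
  strengthens the induction: it prescribes the end blocks on which the next gluing takes
  place.\<close>

lemma toeplitz_completion:
  fixes d :: int and y :: "int \<Rightarrow> complex"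
  assumes d: "0 \<le> d" and fin: "finite S" and psd: "psd_kernel S (\<lambda>u v. y (u - v))"
    and S0: "{0..<d} \<subseteq> S" and S: "\<And>q. q \<le> n \<Longrightarrow> {d*2^q..<d*2^q+d} \<subseteq> S"
  shows "i \<le> n \<Longrightarrow> \<exists>X. psd_kernel {0..<d*2^i+d} X \<and>
    (\<forall>u\<in>{0..<d*2^i+d}. \<forall>v\<in>{0..<d*2^i+d}. \<bar>u - v\<bar> \<le> d \<longrightarrow> X u v = y (u - v)) \<and>
    (\<forall>u\<in>{0..<d} \<union> {d*2^i..<d*2^i+d}. \<forall>v\<in>{0..<d} \<union> {d*2^i..<d*2^i+d}. X u v = y (u - v))"
proof (induction i)
  case 0
  \<comment> \<open>At the start the interval consists of the two adjacent blocks at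
    \<open>0\<close> and \<open>d\<close>, so nothing has to be completed.\<close>
  have "{0..<d*2^0+d} \<subseteq> S"
  proof -
    have "{0..<d*2^0+d} \<subseteq> {0..<d} \<union> {d*2^0..<d*2^0+d}" by auto
    then show ?thesis using S0 S[of 0] by blast
  qed
  then have "psd_kernel {0..<d*2^0+d} (\<lambda>u v. y (u - v))"
    using psd_kernel_mono[OF psd fin] by blast
  then show ?case by blast
next
  case (Suc i)
  define m where "m = d * 2^i"
  have dm: "d \<le> m" using d by (simp add: m_def mult_le_cancel_left1)
  have m2: "d * 2^Suc i = 2 * m" by (simp add: m_def)
  obtain X where X: "psd_kernel {0..<m+d} X"
    "\<And>u v. u \<in> {0..<m+d} \<Longrightarrow> v \<in> {0..<m+d} \<Longrightarrow> \<bar>u - v\<bar> \<le> d \<Longrightarrow> X u v = y (u - v)"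
    "\<And>u v. u \<in> {0..<d} \<union> {m..<m+d} \<Longrightarrow> v \<in> {0..<d} \<union> {m..<m+d} \<Longrightarrow> X u v = y (u - v)"
    using Suc.IH[folded m_def] Suc.prems Suc_leD by blast
  have "{0..<d} \<union> {m..<m+d} \<union> {2*m..<2*m+d} \<subseteq> S"
    using S0 S[of i, folded m_def] S[of "Suc i", unfolded m2] Suc.prems by simp
  then have "psd_kernel ({0..<d} \<union> {m..<m+d} \<union> {2*m..<2*m+d}) (\<lambda>u v. y (u - v))"
    by (rule psd_kernel_mono[OF psd fin])
  from toeplitz_completion_double[OF d dm X this] obtain Z where
    "psd_kernel {0..<2*m+d} Z"
    "\<And>u v. u \<in> {0..<2*m+d} \<Longrightarrow> v \<in> {0..<2*m+d} \<Longrightarrow> \<bar>u - v\<bar> \<le> d \<Longrightarrow> Z u v = y (u - v)"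
    "\<And>u v. u \<in> {0..<d} \<union> {2*m..<2*m+d} \<Longrightarrow> v \<in> {0..<d} \<union> {2*m..<2*m+d} \<Longrightarrow> Z u v = y (u - v)"
    by blast
  then show ?case unfolding m2 by blast
qed

section \<open>Moments on roots of unity\<close>

text \<open>\<open>x\<close> selects the root of unity and \<open>m\<close> is the exponent; the
  exponent is an integer because differences of frequencies occur.\<close>

definition root_char :: "nat \<Rightarrow> nat \<Rightarrow> int \<Rightarrow> complex" where
  "root_char N x m = cis (2 * pi * real x * of_int m / real N)"

lemma root_char_add: "root_char N x (m + m') = root_char N x m * root_char N x m'"
  by (simp add: root_char_def cis_mult add_divide_distrib ring_distribs)

lemma root_char_uminus: "root_char N x (- m) = cnj (root_char N x m)"
  by (simp add: root_char_def cis_cnj)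

lemma root_char_0 [simp]: "root_char N x 0 = 1"
  by (simp add: root_char_def)

lemma norm_root_char [simp]: "norm (root_char N x m) = 1"
  by (simp add: root_char_def)

lemma root_char_nat: "root_char N x (int m) = root_char N x 1 ^ m"
  by (simp add: root_char_def DeMoivre mult_ac)

lemma root_char_power: "root_char N x m = root_char N 1 m ^ x"
  by (simp add: root_char_def DeMoivre mult_ac)

lemma root_char_eq_1_iff:
  assumes "N > 0"
  shows "root_char N x m = 1 \<longleftrightarrow> int N dvd int x * m"
proof
  assume "root_char N x m = 1"
  then have "cos (2 * pi * real x * of_int m / real N) = 1"
    by (simp add: root_char_def complex_eq_iff)
  then obtain j :: int where "2 * pi * real x * of_int m / real N = of_int j * 2 * pi"
    using cos_one_2pi_int by blast
  then have "real x * of_int m = of_int j * real N"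
    using assms by (simp add: field_simps)
  then have "of_int (int x * m) = (of_int (int N * j) :: real)"
    by (simp add: mult.commute)
  then have "int x * m = int N * j"
    by (simp only: of_int_eq_iff)
  then show "int N dvd int x * m" by simp
next
  assume "int N dvd int x * m"
  then obtain j where "int x * m = int N * j" by blast
  then have "of_int (int x * m) = (of_int (int N * j) :: real)" by simp
  then have "2 * pi * real x * of_int m / real N = 2 * pi * of_int j"
    using assms by (simp add: field_simps)
  then show "root_char N x m = 1"
    by (simp add: root_char_def cis_multiple_2pi)
qed

lemma root_char_period: "N > 0 \<Longrightarrow> root_char N x (m + int N) = root_char N x m"
  using root_char_eq_1_iff[of N x "int N"] by (simp add: root_char_add)

lemma root_char_inj:
  assumes "x < N" "w < N" "root_char N x 1 = root_char N w 1"
  shows "x = w"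
proof -
  have *: "x' = w'" if "x' \<le> w'" "w' < N" "root_char N x' 1 = root_char N w' 1" for x' w'
  proof -
    have N: "N > 0" using that by simp
    have "root_char N w' 1 = root_char N x' 1 * root_char N (w' - x') 1"
      using that(1) by (simp add: root_char_def cis_mult of_nat_diff ring_distribs add_divide_distrib diff_divide_distrib)
    then have "root_char N (w' - x') 1 = 1"
      using that(3) norm_root_char[of N x' 1] by (metis mult_cancel_left2 norm_zero zero_neq_one)
    then have "N dvd w' - x'"
      using root_char_eq_1_iff[OF N, of "w' - x'" 1] by (simp flip: of_nat_diff)
    then show ?thesis using that by (auto dest!: dvd_imp_le)
  qed
  show ?thesis using *[of x w] *[of w x] assms by (cases "x \<le> w") auto
qed

text \<open>Orthogonality of characters, from a geometric series whose ratio is an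
  \<open>N\<close>-th root of unity.\<close>

lemma sum_root_char:
  assumes "N > 0"
  shows "(\<Sum>x<N. root_char N x m) = (if int N dvd m then of_nat N else 0)"
proof (cases "int N dvd m")
  case True
  then have "root_char N x m = 1" for x
    using root_char_eq_1_iff[OF assms] by simp
  then show ?thesis using True by simp
next
  case False
  then have "root_char N 1 m \<noteq> 1"
    using root_char_eq_1_iff[OF assms, of 1 m] by simp
  moreover have "root_char N 1 m ^ N = 1"
    using root_char_eq_1_iff[OF assms, of N m] root_char_power[of N N m] by simp
  moreover have "(\<Sum>x<N. root_char N x m) = (\<Sum>x<N. root_char N 1 m ^ x)"
    by (subst root_char_power) simp
  ultimately show ?thesis using False by (simp add: geometric_sum)
qed

text \<open>A positive definite function on \<open>\<int>/N\<int>\<close> is the Fourier transform of a nonnegative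
  measure (Bochner); only one band of the kernel has to be translation invariant.\<close>

lemma kernel_moments:
  fixes X :: "int \<Rightarrow> int \<Rightarrow> complex"
  assumes N: "N > 0" and psd: "psd_kernel {0..<int N} X"
  obtains \<mu> :: "nat \<Rightarrow> real" where "\<And>x. 0 \<le> \<mu> x"
    and "\<And>m z. (\<And>v. v \<in> {0..<int N} \<Longrightarrow> X ((v + m) mod int N) v = z) \<Longrightarrow>
      (\<Sum>x<N. of_real (\<mu> x) * root_char N x m) = z"
proof -
  define I where "I = {0..<int N}"
  define h where "h x = herm_form I X (root_char N x) (root_char N x)" for x
  \<comment> \<open>One factor \<open>N\<close> comes from the orthogonality relation, the other
    from the \<open>N\<close> entries of a cyclic diagonal.\<close>
  define \<mu> where "\<mu> x = Re (h x) / (real N)\<^sup>2" for x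
  have h_real: "of_real (Re (h x)) = h x" for x
  proof -
    have "h x = cnj (h x)" unfolding h_def I_def by (rule herm_form_sym[OF psd])
    then show ?thesis by (simp add: complex_eq_iff)
  qed
  show ?thesis
  proof
    show "0 \<le> \<mu> x" for x
      unfolding \<mu>_def h_def I_def using psd_kernel_nonneg[OF psd] by simp
    fix m z assume z: "\<And>v. v \<in> {0..<int N} \<Longrightarrow> X ((v + m) mod int N) v = z"
    have "(\<Sum>x<N. h x * root_char N x m) = (\<Sum>x<N. \<Sum>u\<in>I. \<Sum>v\<in>I. X u v * root_char N x (v + m - u))"
      unfolding h_def herm_form_def
      by (simp add: sum_distrib_right sum_distrib_left root_char_add root_char_uminus mult_ac
          flip: root_char_uminus add_uminus_conv_diff)
    also have "\<dots> = (\<Sum>u\<in>I. \<Sum>x<N. \<Sum>v\<in>I. X u v * root_char N x (v + m - u))"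
      by (rule sum.swap)
    also have "\<dots> = (\<Sum>u\<in>I. \<Sum>v\<in>I. \<Sum>x<N. X u v * root_char N x (v + m - u))"
      by (intro sum.cong refl sum.swap)
    also have "\<dots> = (\<Sum>u\<in>I. \<Sum>v\<in>I. X u v * (if int N dvd v + m - u then of_nat N else 0))"
      by (simp add: sum_root_char[OF N] flip: sum_distrib_left)
    also have "\<dots> = (\<Sum>v\<in>I. \<Sum>u\<in>I. X u v * (if int N dvd v + m - u then of_nat N else 0))"
      by (rule sum.swap)
    also have "\<dots> = (\<Sum>v\<in>I. z * of_nat N)"
    proof (intro sum.cong refl)
      fix v assume v: "v \<in> I"
      \<comment> \<open>For fixed \<open>v\<close>, orthogonality singles out one \<open>u\<close>,
        and the entry there lies on the cyclic diagonal with constant value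
        \<open>z\<close>.\<close>
      have "(int N dvd v + m - u) = (u = (v + m) mod int N)" if "u \<in> I" for u
        using that by (auto simp: I_def mod_eq_dvd_iff[symmetric] mod_pos_pos_trivial)
      then have "(\<Sum>u\<in>I. X u v * (if int N dvd v + m - u then of_nat N else 0)) =
        (\<Sum>u\<in>I. if u = (v + m) mod int N then X u v * of_nat N else 0)"
        by (intro sum.cong) auto
      also have "\<dots> = X ((v + m) mod int N) v * of_nat N"
        using N by (simp add: I_def)
      finally show "(\<Sum>u\<in>I. X u v * (if int N dvd v + m - u then of_nat N else 0)) = z * of_nat N"
        using z v by (simp add: I_def)
    qed
    also have "\<dots> = z * (of_nat N)\<^sup>2"
      by (simp add: I_def power2_eq_square)
    finally have *: "(\<Sum>x<N. h x * root_char N x m) = z * (of_nat N)\<^sup>2" .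
    have "(\<Sum>x<N. of_real (\<mu> x) * root_char N x m) = (\<Sum>x<N. h x * root_char N x m) / (of_nat N)\<^sup>2"
      by (simp add: \<mu>_def h_real sum_divide_distrib)
    also have "\<dots> = z" using N by (simp add: *)
    finally show "(\<Sum>x<N. of_real (\<mu> x) * root_char N x m) = z" .
  qed
qed

text \<open>The completed interval has \<open>d\<close> points more than one period. Periodicity of
  \<open>y\<close> makes the first and the last \<open>d\<close> points equivalent, so the band
  closes up around \<int>/N\<int>.\<close>

lemma toeplitz_moments:
  fixes d n :: nat and y :: "int \<Rightarrow> complex"
  defines "N \<equiv> d * 2 ^ n"
  assumes d: "d > 0" and fin: "finite S" and psd: "psd_kernel S (\<lambda>u v. y (u - v))"
    and S0: "{0..<int d} \<subseteq> S" and S: "\<And>q. q \<le> n \<Longrightarrow> {int d*2^q..<int d*2^q+int d} \<subseteq> S"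
    and period: "\<And>m. y (m + int N) = y m"
  obtains \<mu> :: "nat \<Rightarrow> real" where "\<And>x. 0 \<le> \<mu> x"
    and "\<And>m. m \<le> d \<Longrightarrow> (\<Sum>x<N. of_real (\<mu> x) * root_char N x (int m)) = y (int m)"
proof -
  have N: "N > 0" "d \<le> N" using d by (simp_all add: N_def)
  have iN: "int d * 2 ^ n = int N" by (simp add: N_def)
  define I where "I = {0..<int N + int d}"
  obtain X where X: "psd_kernel I X"
    and band: "\<And>u v. u \<in> I \<Longrightarrow> v \<in> I \<Longrightarrow> \<bar>u - v\<bar> \<le> int d \<Longrightarrow> X u v = y (u - v)"
    and ends: "\<And>u v. u \<in> {0..<int d} \<union> {int N..<int N+int d} \<Longrightarrow>
      v \<in> {0..<int d} \<union> {int N..<int N+int d} \<Longrightarrow> X u v = y (u - v)"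
    using toeplitz_completion[of "int d" S y n n, OF _ fin psd S0 S, unfolded iN]
    unfolding I_def by (metis of_nat_0_le_iff order_refl)
  have fI: "finite I" by (simp add: I_def)
  \<comment> \<open>The difference of the unit vectors at \<open>v\<close> and
    \<open>v + int N\<close> has form \<open>y 0 - y (- int N) - y (int N) + y 0 = 0\<close>. It is
    thus a null vector, and the two rows coincide.\<close>
  have wrap: "X v u = X (v + int N) u" if v: "v \<in> {0..<int d}" and u: "u \<in> I" for u v
  proof -
    define e :: "int \<Rightarrow> int \<Rightarrow> complex" where "e s = (\<lambda>t. if t = s then 1 else 0)" for s
    have vI: "v \<in> I" "v + int N \<in> I" using v N by (auto simp: I_def)
    have form_e: "herm_form I X (e s) (e t) = X s t" if "s \<in> I" "t \<in> I" for s t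
      unfolding e_def using that fI herm_form_delta_left[OF fI that(1), of X "e t"]
      by (simp add: e_def if_distrib[of "\<lambda>x. _ * x"] cong: if_cong)
    define w where "w t = e v t + (-1) * e (v + int N) t" for t
    have "y (- int N) = y 0" using period[of "- int N"] by simp
    then have "herm_form I X w w = 0"
      unfolding w_def herm_form_add_left herm_form_add_right herm_form_scale_left herm_form_scale_right
      using vI v ends[of v v] ends[of v "v + int N"] ends[of "v + int N" v]
        ends[of "v + int N" "v + int N"] period[of 0] by (simp add: form_e)
    then have "herm_form I X (e u) w = 0"
      by (intro herm_form_null[OF X]) simp
    then have "X u v = X u (v + int N)"
      unfolding w_def herm_form_add_right herm_form_scale_right using vI u by (simp add: form_e)
    then show ?thesis
      using psd_kernel_sym[OF X u vI(1)] psd_kernel_sym[OF X u vI(2)] by simp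
  qed
  have sub: "psd_kernel {0..<int N} X"
    by (rule psd_kernel_mono[OF X fI]) (auto simp: I_def)
  obtain \<mu> where \<mu>: "\<And>x. 0 \<le> \<mu> x" "\<And>m z. (\<And>v. v \<in> {0..<int N} \<Longrightarrow> X ((v + m) mod int N) v = z) \<Longrightarrow>
      (\<Sum>x<N. of_real (\<mu> x) * root_char N x m) = z"
    using kernel_moments[OF N(1) sub] by blast
  have "X ((v + int m) mod int N) v = y (int m)" if "m \<le> d" "v \<in> {0..<int N}" for m v
  proof (cases "v + int m < int N")
    case True
    then show ?thesis
      using that band[of "v + int m" v] by (simp add: I_def)
  next
    case False
    then have "(v + int m) mod int N = v + int m - int N"
      using that N by (subst minus_mod_self2[symmetric], intro mod_pos_pos_trivial) auto
    moreover have "v + int m - int N \<in> {0..<int d}"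
      using False that by auto
    \<comment> \<open>The reduced row index is below \<open>d\<close>, so \<open>wrap\<close>
      replaces it by \<open>v + int m\<close>, which is within the band around
      \<open>v\<close>.\<close>
    ultimately show ?thesis
      using wrap[of "v + int m - int N" v] band[of "v + int m" v] that by (simp add: I_def)
  qed
  with \<mu> that show ?thesis by blast
qed

section \<open>The lower bound for LP lifts\<close>

text \<open>The bound for cover-free families: a member with at least \<open>d + 1\<close> points can be removed
  together with its points, lowering \<open>d\<close> by one; if there is none, every member has a point
  of its own.\<close>

lemma cover_free_card:
  assumes "finite I" "finite G" "\<And>x. x \<in> I \<Longrightarrow> S x \<subseteq> G"
    and "\<And>x F. x \<in> I \<Longrightarrow> F \<subseteq> I - {x} \<Longrightarrow> card F \<le> d \<Longrightarrow> \<not> S x \<subseteq> \<Union> (S ` F)"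
  shows "min (2 * card I) ((d + 1) * (d + 2)) \<le> 2 * card G"
  using assms
proof (induction d arbitrary: I G S)
  case 0
  show ?case
  proof (cases "I = {}")
    case False
    then obtain x where x: "x \<in> I" by blast
    then have "S x \<noteq> {}" using "0.prems"(4)[of x "{}"] by auto
    then have "G \<noteq> {}" using "0.prems"(3)[OF x] by auto
    then have "card G \<ge> 1" using \<open>finite G\<close> by (simp add: Suc_le_eq card_gt_0_iff)
    then show ?thesis by simp
  qed simp
next
  case (Suc d)
  note fI = Suc.prems(1) and fG = Suc.prems(2) and SG = Suc.prems(3) and cf = Suc.prems(4)
  show ?case
  proof (cases "\<exists>x\<in>I. d + 2 \<le> card (S x)")
    case True
    then obtain x where x: "x \<in> I" "d + 2 \<le> card (S x)" by blast
    have IH: "min (2 * card (I - {x})) ((d + 1) * (d + 2)) \<le> 2 * card (G - S x)"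
    proof (rule Suc.IH[of "I - {x}" "G - S x" "\<lambda>w. S w - S x"])
      fix w F assume w: "w \<in> I - {x}" and F: "F \<subseteq> I - {x} - {w}" "card F \<le> d"
      have "finite F" using F fI finite_subset by blast
      \<comment> \<open>Adding \<open>x\<close> to a cover of \<open>S w - S x\<close> gives a cover
        of \<open>S w\<close>; this costs the one member by which \<open>d\<close> drops.\<close>
      then have "card (insert x F) \<le> Suc d" using F(2) by (simp add: card_insert_if)
      moreover have "insert x F \<subseteq> I - {w}" using F x w by blast
      ultimately have "\<not> S w \<subseteq> \<Union> (S ` insert x F)" using cf[of w "insert x F"] w by blast
      then show "\<not> S w - S x \<subseteq> (\<Union>w\<in>F. S w - S x)" by auto
    qed (use fI fG SG in auto)
    have cG: "card (G - S x) + card (S x) = card G"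
      using SG[OF x(1)] fG finite_subset[OF SG[OF x(1)] fG] by (simp add: card_Diff_subset card_mono)
    have cI: "card (I - {x}) + 1 = card I"
      using x fI by (metis Suc_eq_plus1 card_Suc_Diff1)
    from IH have "2 * card I \<le> 2 * card G \<or> (d + 1) * (d + 2) + 2 * (d + 2) \<le> 2 * card G"
      unfolding min_le_iff_disj
    proof (elim disjE)
      assume "2 * card (I - {x}) \<le> 2 * card (G - S x)"
      then have "2 * card I \<le> 2 * card G" using cG cI x(2) by linarith
      then show ?thesis ..
    next
      assume "(d + 1) * (d + 2) \<le> 2 * card (G - S x)"
      then have "(d + 1) * (d + 2) + 2 * (d + 2) \<le> 2 * card (G - S x) + 2 * card (S x)"
        using x(2) by (intro add_mono) simp_all
      also have "\<dots> = 2 * card G" using cG by simp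
      finally show ?thesis ..
    qed
    \<comment> \<open>The \<open>d + 2\<close> points of \<open>S x\<close>, counted twice, are
      exactly the increment of the bound.\<close>
    moreover have "(Suc d + 1) * (Suc d + 2) = (d + 1) * (d + 2) + 2 * (d + 2)"
      by simp
    ultimately show ?thesis by (simp only: min_le_iff_disj)
  next
    case False
    have "\<exists>g. g \<in> S x \<and> (\<forall>w\<in>I - {x}. g \<notin> S w)" if x: "x \<in> I" for x
    proof (rule ccontr)
      assume "\<not> ?thesis"
      then have "\<forall>g\<in>S x. \<exists>w. w \<in> I - {x} \<and> g \<in> S w" by blast
      \<comment> \<open>Without a private point, one other member per point of \<open>S x\<close>
        would cover \<open>S x\<close> with at most \<open>d + 1\<close> members.\<close>
      then obtain w where w: "\<And>g. g \<in> S x \<Longrightarrow> w g \<in> I - {x} \<and> g \<in> S (w g)" by metis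
      have "finite (S x)" using SG[OF x] fG finite_subset by blast
      then have "card (w ` S x) \<le> card (S x)" by (rule card_image_le)
      also have "\<dots> \<le> Suc d" using False x by force
      finally have "\<not> S x \<subseteq> \<Union> (S ` w ` S x)"
        using w by (intro cf[OF x]) auto
      then show False using w by auto
    qed
    then obtain g where g: "\<And>x. x \<in> I \<Longrightarrow> g x \<in> S x" "\<And>x w. x \<in> I \<Longrightarrow> w \<in> I - {x} \<Longrightarrow> g x \<notin> S w"
      by metis
    have "inj_on g I"
      using g by (intro inj_onI) (metis DiffI singletonD)
    moreover have "g ` I \<subseteq> G" using g SG by blast
    ultimately have "card I \<le> card G" using fG by (rule card_inj_on_le)
    then show ?thesis by simp
  qed
qed

section \<open>Supports of lifts in the orthant\<close>

text \<open>This measures how far one can move from \<open>z\<close> away from \<open>x\<close>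
  inside the orthant: \<open>e\<close> is bounded by the ratios \<open>z j / x j\<close> at the
  nonzero \<open>x j\<close>.\<close>

lemma common_scale:
  fixes x z :: "nat \<Rightarrow> real"
  assumes "\<And>j. j < k \<Longrightarrow> 0 \<le> x j" "\<And>j. j < k \<Longrightarrow> 0 \<le> z j" "\<And>j. j < k \<Longrightarrow> z j = 0 \<Longrightarrow> x j = 0"
  shows "\<exists>e>0. \<forall>j<k. e * x j \<le> z j"
  using assms
proof (induction k)
  case 0
  then show ?case by (auto intro: exI[of _ 1])
next
  case (Suc k)
  then obtain e where e: "e > 0" "\<And>j. j < k \<Longrightarrow> e * x j \<le> z j"
    by (metis less_Suc_eq)
  obtain e' where e': "e' > 0" "e' * x k \<le> z k"
  proof (cases "x k = 0")
    case True
    then show ?thesis using that[of 1] Suc.prems(2)[of k] by simp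
  next
    case False
    then have "x k > 0" "z k > 0"
      using Suc.prems(1)[of k] Suc.prems(2)[of k] Suc.prems(3)[of k] by fastforce+
    then show ?thesis using that[of "z k / x k"] by simp
  qed
  have "min e e' * x j \<le> z j" if "j < Suc k" for j
  proof (cases "j = k")
    case True
    have "min e e' * x k \<le> e' * x k" using Suc.prems(1)[of k] by (intro mult_right_mono) auto
    then show ?thesis using True e' by simp
  next
    case False
    then have "min e e' * x j \<le> e * x j" using Suc.prems(1)[of j] that by (intro mult_right_mono) auto
    also have "\<dots> \<le> z j" using e(2) False that by simp
    finally show ?thesis .
  qed
  then show ?case using e(1) e'(1) by (intro exI[of _ "min e e'"]) auto
qed

text \<open>The coefficients \<open>s\<close>, \<open>t\<close> may be negative, since the support
  argument extrapolates beyond a segment.\<close>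

definition affine_functional :: "nat \<Rightarrow> (real vec \<Rightarrow> real) \<Rightarrow> bool" where
  "affine_functional m l \<longleftrightarrow> (\<forall>p\<in>carrier_vec m. \<forall>q\<in>carrier_vec m. \<forall>s t. s + t = 1 \<longrightarrow>
     l (s \<cdot>\<^sub>v p + t \<cdot>\<^sub>v q) = s * l p + t * l q)"

text \<open>Otherwise the point could be pushed away from the face, past the lift of \<open>x\<close>, without
  leaving the orthant.\<close>

lemma lp_lift_support:
  assumes lin: "real_linear_map (+) (\<cdot>\<^sub>v) (carrier_vec k) m f"
    and aff: "affine_subspace (+) (\<cdot>\<^sub>v) (carrier_vec k) L"
    and l: "affine_functional m l"
    and nonneg: "\<And>z. z \<in> nonneg_orthant k \<inter> L \<Longrightarrow> 0 \<le> l (f z)"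
    and F: "finite F" "F \<noteq> {}" "F \<subseteq> nonneg_orthant k \<inter> L" "\<And>w. w \<in> F \<Longrightarrow> l (f w) = 0"
    and x: "x \<in> nonneg_orthant k \<inter> L" "0 < l (f x)"
  shows "\<exists>j<k. x $ j \<noteq> 0 \<and> (\<forall>w\<in>F. w $ j = 0)"
proof (rule ccontr)
  assume neg: "\<not> ?thesis"
  have carr: "nonneg_orthant k \<subseteq> carrier_vec k" by (auto simp: nonneg_orthant_def)
  have lf: "l (f (s \<cdot>\<^sub>v p + t \<cdot>\<^sub>v q)) = s * l (f p) + t * l (f q)"
    if "p \<in> carrier_vec k" "q \<in> carrier_vec k" "s + t = 1" for p q s t
  proof -
    have "f (s \<cdot>\<^sub>v p + t \<cdot>\<^sub>v q) = s \<cdot>\<^sub>v f p + t \<cdot>\<^sub>v f q"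
      using lin that unfolding real_linear_map_def by simp
    moreover have "f p \<in> carrier_vec m" "f q \<in> carrier_vec m"
      using lin that unfolding real_linear_map_def by auto
    ultimately show ?thesis using l that unfolding affine_functional_def by simp
  qed
  have affD: "s \<cdot>\<^sub>v p + t \<cdot>\<^sub>v q \<in> L" if "p \<in> L" "q \<in> L" "s + t = 1" for p q s t
    using aff that unfolding affine_subspace_def by blast
  \<comment> \<open>Repeated midpoints of the members of \<open>F\<close> give one point over the
    face whose support contains all of theirs.\<close>
  have "\<exists>z\<in>nonneg_orthant k \<inter> L. l (f z) = 0 \<and> (\<forall>j<k. z $ j = 0 \<longrightarrow> (\<forall>w\<in>F. w $ j = 0))"
    using F
  proof (induction F rule: finite_ne_induct)
    case (singleton w)
    then show ?case by (intro bexI[of _ w]) auto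
  next
    case (insert w F)
    then obtain z where z: "z \<in> nonneg_orthant k \<inter> L" "l (f z) = 0"
      "\<And>j. j < k \<Longrightarrow> z $ j = 0 \<Longrightarrow> \<forall>w\<in>F. w $ j = 0" by auto
    have w: "w \<in> nonneg_orthant k \<inter> L" "l (f w) = 0" using insert.prems by auto
    have c: "z \<in> carrier_vec k" "w \<in> carrier_vec k" using z w carr by auto
    define u where "u = (1/2) \<cdot>\<^sub>v z + (1/2) \<cdot>\<^sub>v w"
    have u: "u $ j = (z $ j + w $ j) / 2" if "j < k" for j
      using that c by (simp add: u_def)
    have pos: "0 \<le> z $ j" "0 \<le> w $ j" if "j < k" for j
      using that z(1) w(1) by (auto simp: nonneg_orthant_def)
    have "u \<in> carrier_vec k" using c by (simp add: u_def)
    then have "u \<in> nonneg_orthant k" using pos by (auto simp: nonneg_orthant_def u)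
    moreover have "u \<in> L" unfolding u_def using z w by (intro affD) auto
    moreover have "l (f u) = 0" unfolding u_def using c z w by (subst lf) auto
    moreover have "\<forall>v\<in>insert w F. v $ j = 0" if "j < k" "u $ j = 0" for j
    proof -
      have "z $ j = 0" "w $ j = 0" using pos[OF that(1)] u[OF that(1)] that(2) by auto
      then show ?thesis using z(3)[OF that(1)] by auto
    qed
    ultimately show ?case by blast
  qed
  then obtain z where z: "z \<in> nonneg_orthant k \<inter> L" "l (f z) = 0"
    "\<And>j. j < k \<Longrightarrow> z $ j = 0 \<Longrightarrow> \<forall>w\<in>F. w $ j = 0" by blast
  have c: "z \<in> carrier_vec k" "x \<in> carrier_vec k" using z x carr by auto
  have pos: "0 \<le> z $ j" "0 \<le> x $ j" if "j < k" for j
    using that z(1) x(1) by (auto simp: nonneg_orthant_def)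
  obtain e where e: "e > 0" "\<And>j. j < k \<Longrightarrow> e * x $ j \<le> z $ j"
    using common_scale[of k "\<lambda>j. x $ j" "\<lambda>j. z $ j"] pos z(3) neg by blast
  \<comment> \<open>Here \<open>u = z + e * (z - x)\<close>, where the functional takes the value
    \<open>- e * l (f x) < 0\<close>.\<close>
  define u where "u = (1 + e) \<cdot>\<^sub>v z + (- e) \<cdot>\<^sub>v x"
  have "u $ j = z $ j + e * z $ j - e * x $ j" if "j < k" for j
    using that c by (simp add: u_def algebra_simps)
  moreover have "u \<in> carrier_vec k" using c by (simp add: u_def)
  ultimately have "u \<in> nonneg_orthant k"
    using e pos by (auto simp: nonneg_orthant_def intro: add_nonneg_nonneg)
      (metis add.commute add_diff_eq add_nonneg_nonneg diff_ge_0_iff_ge less_imp_le mult_nonneg_nonneg)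
  moreover have "u \<in> L" unfolding u_def using z x by (intro affD) auto
  ultimately have "0 \<le> l (f u)" by (intro nonneg) auto
  also have "l (f u) = - e * l (f x)" unfolding u_def using c z by (subst lf) auto
  finally show False using e x by (simp add: mult_le_0_iff)
qed

lemma lp_lift_lower_bound:
  fixes v :: "'i \<Rightarrow> real vec"
  assumes lift: "has_lp_lift m P k" and I: "finite I" "2 \<le> card I" and d: "d > 0"
    and v: "\<And>x. x \<in> I \<Longrightarrow> v x \<in> P"
    and face: "\<And>F. F \<subseteq> I \<Longrightarrow> card F \<le> d \<Longrightarrow> \<exists>l. affine_functional m l \<and> (\<forall>p\<in>P. 0 \<le> l p) \<and>
      (\<forall>x\<in>F. l (v x) = 0) \<and> (\<forall>x\<in>I - F. 0 < l (v x))"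
  shows "min (2 * card I) ((d + 1) * (d + 2)) \<le> 2 * k"
proof -
  obtain f L where lin: "real_linear_map (+) (\<cdot>\<^sub>v) (carrier_vec k) m f"
    and aff: "affine_subspace (+) (\<cdot>\<^sub>v) (carrier_vec k) L"
    and P: "P = f ` (nonneg_orthant k \<inter> L)"
    using lift unfolding has_lp_lift_def has_cone_lift_def by blast
  have "\<forall>x\<in>I. \<exists>z. z \<in> nonneg_orthant k \<inter> L \<and> f z = v x"
    using v unfolding P by (metis imageE)
  then obtain z where z: "\<And>x. x \<in> I \<Longrightarrow> z x \<in> nonneg_orthant k \<inter> L" "\<And>x. x \<in> I \<Longrightarrow> f (z x) = v x"
    by metis
  define S where "S x = {j. j < k \<and> z x $ j \<noteq> 0}" for x
  have *: "\<not> S x \<subseteq> \<Union> (S ` F)" if x: "x \<in> I" and F: "F \<subseteq> I - {x}" "card F \<le> d" "F \<noteq> {}" for x F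
  proof -
    obtain l where l: "affine_functional m l" "\<And>p. p \<in> P \<Longrightarrow> 0 \<le> l p"
      "\<And>w. w \<in> F \<Longrightarrow> l (v w) = 0" "\<And>w. w \<in> I - F \<Longrightarrow> 0 < l (v w)"
      using face[of F] F by blast
    have fF: "finite F" using F I finite_subset by blast
    have "\<exists>j<k. z x $ j \<noteq> 0 \<and> (\<forall>w\<in>z ` F. w $ j = 0)"
    proof (rule lp_lift_support[OF lin aff l(1)])
      show "0 < l (f (z x))" using l(4)[of x] z(2)[OF x] x F by auto
    qed (use l(2,3) z x F fF P in auto)
    then show ?thesis by (auto simp: S_def)
  qed
  have "min (2 * card I) ((d + 1) * (d + 2)) \<le> 2 * card {..<k}"
  proof (rule cover_free_card[of I _ S])
    fix x F assume x: "x \<in> I" and F: "F \<subseteq> I - {x}" "card F \<le> d"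
    show "\<not> S x \<subseteq> \<Union> (S ` F)"
    \<comment> \<open>The support lemma needs a nonempty \<open>F\<close>. For the empty one,
      comparison with a second index \<open>w\<close> shows that \<open>S x\<close> is nonempty;
      this uses \<open>2 \<le> card I\<close>.\<close>
    proof (cases "F = {}")
      case True
      have "\<not> I \<subseteq> {x}" using I card_mono[of "{x}" I] by auto
      then obtain w where "w \<in> I - {x}" by blast
      then show ?thesis using *[OF x, of "{w}"] d True by auto
    qed (use * x F in blast)
  qed (use I in \<open>auto simp: S_def\<close>)
  then show ?thesis by simp
qed

text \<open>The standard simplex of coefficients is a slice of the orthant. The existence of this
  lift ensures that the minimum \<open>xc_lp\<close> is attained.\<close>

lemma has_lp_lift_convex_hull:
  fixes v :: "nat \<Rightarrow> real vec"
  shows "has_lp_lift m {vec m (\<lambda>i. \<Sum>x<N. c x * v x $ i) | c. (\<forall>x<N. 0 \<le> c x) \<and> (\<Sum>x<N. c x) = 1} N"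
  unfolding has_lp_lift_def has_cone_lift_def
proof (intro exI conjI)
  let ?f = "\<lambda>c. vec m (\<lambda>i. \<Sum>x<N. c $ x * v x $ i)"
  let ?L = "{c \<in> carrier_vec N. (\<Sum>x<N. c $ x) = (1::real)}"
  show "real_linear_map (+) (\<cdot>\<^sub>v) (carrier_vec N) m ?f"
    unfolding real_linear_map_def
    by (auto simp: sum.distrib sum_distrib_left algebra_simps intro!: eq_vecI sum.cong)
  show "affine_subspace (+) (\<cdot>\<^sub>v) (carrier_vec N) ?L"
    unfolding affine_subspace_def
    by (auto simp: sum.distrib simp flip: sum_distrib_left)
  show "{vec m (\<lambda>i. \<Sum>x<N. c x * v x $ i) | c. (\<forall>x<N. 0 \<le> c x) \<and> (\<Sum>x<N. c x) = 1} = ?f ` (nonneg_orthant N \<inter> ?L)"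
  proof (intro equalityI subsetI)
    fix p assume "p \<in> {vec m (\<lambda>i. \<Sum>x<N. c x * v x $ i) | c. (\<forall>x<N. 0 \<le> c x) \<and> (\<Sum>x<N. c x) = 1}"
    then obtain c where c: "\<forall>x<N. 0 \<le> c x" "(\<Sum>x<N. c x) = 1" "p = vec m (\<lambda>i. \<Sum>x<N. c x * v x $ i)"
      by blast
    show "p \<in> ?f ` (nonneg_orthant N \<inter> ?L)"
      by (rule image_eqI[of _ _ "vec N c"]) (use c in \<open>auto simp: nonneg_orthant_def intro!: eq_vecI\<close>)
  next
    fix p assume "p \<in> ?f ` (nonneg_orthant N \<inter> ?L)"
    then show "p \<in> {vec m (\<lambda>i. \<Sum>x<N. c x * v x $ i) | c. (\<forall>x<N. 0 \<le> c x) \<and> (\<Sum>x<N. c x) = 1}"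
      by (auto simp: nonneg_orthant_def)
  qed
qed

section \<open>The trigonometric cyclic polytope\<close>

lemma hermitian_mats_iff:
  "A \<in> hermitian_mats k \<longleftrightarrow> A \<in> carrier_mat k k \<and> (\<forall>s<k. \<forall>t<k. A $$ (t, s) = cnj (A $$ (s, t)))"
proof (cases "A \<in> carrier_mat k k")
  case True
  have adj: "mat_adjoint A \<in> carrier_mat k k" "\<And>i j. i < k \<Longrightarrow> j < k \<Longrightarrow> mat_adjoint A $$ (i, j) = cnj (A $$ (j, i))"
    using True by (auto simp: mat_adjoint_def mat_of_rows_def)
  have "mat_adjoint A = A \<longleftrightarrow> (\<forall>s<k. \<forall>t<k. mat_adjoint A $$ (t, s) = A $$ (t, s))"
    using adj(1) True by (auto intro!: eq_matI)
  also have "\<dots> \<longleftrightarrow> (\<forall>s<k. \<forall>t<k. cnj (A $$ (s, t)) = A $$ (t, s))"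
    by (simp add: adj(2))
  also have "\<dots> \<longleftrightarrow> (\<forall>s<k. \<forall>t<k. A $$ (t, s) = cnj (A $$ (s, t)))"
    by (subst eq_commute) (rule refl)
  finally show ?thesis using True unfolding hermitian_mats_def by blast
qed (simp add: hermitian_mats_def)

lemma psd_cone_iff:
  "A \<in> psd_cone k \<longleftrightarrow> A \<in> carrier_mat k k \<and> psd_kernel {..<k} (\<lambda>s t. A $$ (s, t))"
proof (cases "A \<in> hermitian_mats k")
  case True
  then have A: "A \<in> carrier_mat k k" by (simp add: hermitian_mats_def)
  have form: "(A *\<^sub>v v) \<bullet>c v = herm_form {..<k} (\<lambda>s t. A $$ (s, t)) (\<lambda>s. v $ s) (\<lambda>s. v $ s)"
    if "v \<in> carrier_vec k" for v
    using A that unfolding herm_form_def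
    by (auto simp: scalar_prod_def sum_distrib_left mult_ac lessThan_atLeast0 intro!: sum.cong)
  have "(\<forall>v\<in>carrier_vec k. 0 \<le> Re ((A *\<^sub>v v) \<bullet>c v)) \<longleftrightarrow>
    (\<forall>f. 0 \<le> Re (herm_form {..<k} (\<lambda>s t. A $$ (s, t)) f f))"
  proof (intro iffI allI ballI)
    fix f assume "\<forall>v\<in>carrier_vec k. 0 \<le> Re ((A *\<^sub>v v) \<bullet>c v)"
    then have "0 \<le> Re ((A *\<^sub>v vec k f) \<bullet>c vec k f)" by simp
    also have "(A *\<^sub>v vec k f) \<bullet>c vec k f = herm_form {..<k} (\<lambda>s t. A $$ (s, t)) f f"
      by (subst form) (auto simp: herm_form_def intro!: sum.cong)
    finally show "0 \<le> Re (herm_form {..<k} (\<lambda>s t. A $$ (s, t)) f f)" .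
  qed (simp add: form)
  then show ?thesis
    using True A unfolding psd_cone_def psd_kernel_def hermitian_mats_iff by blast
next
  case False
  then show ?thesis unfolding psd_cone_def psd_kernel_def hermitian_mats_iff by blast
qed

section \<open>Vertices and convex combinations\<close>

text \<open>Real parts of \<open>z, z^2, ..., z^d\<close> come first, then the imaginary parts. The
  exponents are shifted by one because the constant frequency \<open>0\<close> is left out.\<close>

definition trig_vertex :: "nat \<Rightarrow> nat \<Rightarrow> nat \<Rightarrow> real vec" where
  "trig_vertex d N x = vec (2 * d) (\<lambda>i. if i < d then Re (root_char N x (int (i + 1)))
     else Im (root_char N x (int (i - d + 1))))"

definition trig_cyclic_polytope :: "nat \<Rightarrow> nat \<Rightarrow> real vec set" where
  "trig_cyclic_polytope d N = convex_hull_vec (2 * d) (trig_vertex d N ` {..<N})"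

lemma inj_on_trig_vertex:
  assumes "d > 0"
  shows "inj_on (trig_vertex d N) {..<N}"
proof (rule inj_onI)
  fix x w assume xw: "x \<in> {..<N}" "w \<in> {..<N}" and eq: "trig_vertex d N x = trig_vertex d N w"
  \<comment> \<open>Coordinates \<open>0\<close> and \<open>d\<close> are the real and the imaginary
    part of the root of unity itself.\<close>
  from arg_cong[OF eq, of "\<lambda>p. p $ 0"] arg_cong[OF eq, of "\<lambda>p. p $ d"] assms
  have "root_char N x 1 = root_char N w 1"
    by (simp add: trig_vertex_def complex_eq_iff)
  then show "x = w" using xw root_char_inj by auto
qed

text \<open>For \<open>d > 0\<close> distinct indices give distinct vertices, so convex coefficients
  can be attached to the indices of the roots of unity.\<close>

lemma trig_cyclic_polytope_eq:
  assumes "d > 0"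
  shows "trig_cyclic_polytope d N = {vec (2 * d) (\<lambda>i. \<Sum>x<N. c x * trig_vertex d N x $ i) | c.
    (\<forall>x<N. 0 \<le> c x) \<and> (\<Sum>x<N. c x) = 1}" (is "_ = ?R")
proof (intro equalityI subsetI)
  note inj = inj_on_trig_vertex[OF assms, of N]
  fix p assume "p \<in> trig_cyclic_polytope d N"
  then obtain c where "\<forall>v\<in>trig_vertex d N ` {..<N}. 0 \<le> c v" "(\<Sum>v\<in>trig_vertex d N ` {..<N}. c v) = 1"
    "p = vec (2 * d) (\<lambda>i. \<Sum>v\<in>trig_vertex d N ` {..<N}. c v * v $ i)"
    unfolding trig_cyclic_polytope_def convex_hull_vec_def by blast
  then show "p \<in> ?R"
    by (auto simp: sum.reindex[OF inj] intro!: exI[of _ "c \<circ> trig_vertex d N"])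
next
  note inj = inj_on_trig_vertex[OF assms, of N]
  fix p assume "p \<in> ?R"
  then obtain c where c: "\<forall>x<N. 0 \<le> c x" "(\<Sum>x<N. c x) = 1"
    "p = vec (2 * d) (\<lambda>i. \<Sum>x<N. c x * trig_vertex d N x $ i)" by blast
  define c' where "c' = c \<circ> inv_into {..<N} (trig_vertex d N)"
  have c': "c' (trig_vertex d N x) = c x" if "x < N" for x
    using that inv_into_f_f[OF inj] by (simp add: c'_def)
  have "p = vec (2 * d) (\<lambda>i. \<Sum>v\<in>trig_vertex d N ` {..<N}. c' v * v $ i)"
    unfolding c(3) by (simp add: sum.reindex[OF inj] c')
  moreover have "(\<Sum>v\<in>trig_vertex d N ` {..<N}. c' v) = 1"
    using c(2) by (simp add: sum.reindex[OF inj] c')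
  moreover have "\<forall>v\<in>trig_vertex d N ` {..<N}. 0 \<le> c' v"
    using c(1) by (simp add: c')
  ultimately show "p \<in> trig_cyclic_polytope d N"
    unfolding trig_cyclic_polytope_def convex_hull_vec_def by blast
qed

section \<open>The Hermitian PSD lift\<close>

text \<open>A nonnegative combination of rank-one kernels: the form at \<open>f\<close> is the sum
  of \<open>c x * (norm (q x))^2\<close>.\<close>

lemma psd_kernel_moments:
  assumes "\<And>x. x < N \<Longrightarrow> 0 \<le> c x"
  shows "psd_kernel S (\<lambda>s t. \<Sum>x<N. of_real (c x) * root_char N x (\<phi> s - \<phi> t))"
  unfolding psd_kernel_def
proof (intro conjI ballI allI)
  fix s t
  show "(\<Sum>x<N. of_real (c x) * root_char N x (\<phi> t - \<phi> s)) =
    cnj (\<Sum>x<N. of_real (c x) * root_char N x (\<phi> s - \<phi> t))"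
    by (simp flip: root_char_uminus)
next
  fix f
  define q where "q x = (\<Sum>t\<in>S. root_char N x (- \<phi> t) * f t)" for x
  have "herm_form S (\<lambda>s t. \<Sum>x<N. of_real (c x) * root_char N x (\<phi> s - \<phi> t)) f f =
    (\<Sum>s\<in>S. \<Sum>t\<in>S. \<Sum>x<N. of_real (c x) * cnj (root_char N x (- \<phi> s) * f s) * (root_char N x (- \<phi> t) * f t))"
    unfolding herm_form_def
    by (simp add: sum_distrib_left sum_distrib_right mult_ac flip: root_char_uminus root_char_add)
  also have "\<dots> = (\<Sum>s\<in>S. \<Sum>x<N. \<Sum>t\<in>S. of_real (c x) * cnj (root_char N x (- \<phi> s) * f s) * (root_char N x (- \<phi> t) * f t))"
    by (intro sum.cong refl sum.swap)
  also have "\<dots> = (\<Sum>x<N. \<Sum>s\<in>S. \<Sum>t\<in>S. of_real (c x) * cnj (root_char N x (- \<phi> s) * f s) * (root_char N x (- \<phi> t) * f t))"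
    by (rule sum.swap)
  also have "\<dots> = (\<Sum>x<N. of_real (c x) * (cnj (q x) * q x))"
    unfolding q_def cnj_sum sum_product by (simp add: sum_distrib_left mult_ac)
  also have "\<dots> = of_real (\<Sum>x<N. c x * (norm (q x))\<^sup>2)"
    by (simp add: complex_norm_square mult.commute flip: of_real_power)
  finally show "0 \<le> Re (herm_form S (\<lambda>s t. \<Sum>x<N. of_real (c x) * root_char N x (\<phi> s - \<phi> t)) f f)"
    using assms by (auto intro!: sum_nonneg)
qed

text \<open>An enumeration of the blocks \<open>{0..<d}\<close> and \<open>{d 2^q..<d 2^q + d}\<close> for \<open>q = 0, 1, \<dots>\<close>\<close>

definition sparse_freq :: "nat \<Rightarrow> nat \<Rightarrow> int" where
  "sparse_freq d s = (if s < d then int s else int (s mod d) + int d * 2 ^ (s div d - 1))"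

text \<open>The blocks at \<open>0\<close> and \<open>d\<close> are adjacent. The case
  \<open>s = d\<close> is included because the entry \<open>(d, 0)\<close> has to hold the highest
  moment.\<close>

lemma sparse_freq_le:
  assumes "s \<le> d" "d > 0"
  shows "sparse_freq d s = int s"
  using assms by (cases "s = d") (auto simp: sparse_freq_def)

text \<open>Block \<open>q\<close> occupies the indices with quotient \<open>q + 1\<close> by
  \<open>d\<close>, quotient \<open>0\<close> being the initial block; hence the size
  \<open>d * (n + 2)\<close>.\<close>

lemma sparse_freq_block:
  assumes "d > 0" "q \<le> n"
  shows "{int d * 2 ^ q..<int d * 2 ^ q + int d} \<subseteq> sparse_freq d ` {..<d * (n + 2)}"
proof
  fix u assume u: "u \<in> {int d * 2 ^ q..<int d * 2 ^ q + int d}"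
  define a where "a = nat (u - int d * 2 ^ q)"
  have a: "a < d" "u = int d * 2 ^ q + int a" using u by (auto simp: a_def)
  have "(a + d * (q + 1)) div d = q + 1" "(a + d * (q + 1)) mod d = a"
    using a assms by (auto simp del: mult_Suc_right)
  moreover have "\<not> a + d * (q + 1) < d" by simp
  ultimately have "sparse_freq d (a + d * (q + 1)) = u"
    unfolding sparse_freq_def a(2) by simp
  moreover have "a + d * (q + 1) < d * (n + 2)"
  proof -
    have "a + d * (q + 1) < d * (q + 2)" using a by simp
    also have "\<dots> \<le> d * (n + 2)" using assms by simp
    finally show ?thesis .
  qed
  ultimately show "u \<in> sparse_freq d ` {..<d * (n + 2)}" by blast
qed

lemma has_psd_lift_trig_cyclic_polytope:
  assumes d: "d > 0"
  shows "has_psd_lift (2 * d) (trig_cyclic_polytope d (d * 2 ^ n)) (d * (n + 2))"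
proof -
  define N k where "N = d * 2 ^ n" and "k = d * (n + 2)"
  have N: "N > 0" using d by (simp add: N_def)
  have dk: "d < k" using d by (simp add: k_def)
  define \<phi> where "\<phi> = sparse_freq d"
  have \<phi>: "\<phi> s = int s" if "s \<le> d" for s
    using sparse_freq_le[OF that d] by (simp add: \<phi>_def)
  \<comment> \<open>The column of frequency \<open>0\<close> contains \<open>y 1, ..., y d\<close>;
    real and imaginary parts are real-linear in the matrix.\<close>
  define f :: "complex mat \<Rightarrow> real vec" where
    "f A = vec (2 * d) (\<lambda>i. if i < d then Re (A $$ (i + 1, 0)) else Im (A $$ (i - d + 1, 0)))" for A
  \<comment> \<open>Periodicity is imposed because the last block starts at \<open>N\<close> and has
    to represent the same residues as the first.\<close>
  define L where "L = {A \<in> hermitian_mats k. \<exists>y. (\<forall>m. y (m + int N) = y m) \<and> y 0 = 1 \<and>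
    (\<forall>s<k. \<forall>t<k. A $$ (s, t) = y (\<phi> s - \<phi> t))}"
  have "real_linear_map (+) real_smult_mat (hermitian_mats k) (2 * d) f"
    unfolding real_linear_map_def hermitian_mats_def using dk by (auto simp: f_def intro!: eq_vecI)
  moreover have "affine_subspace (+) real_smult_mat (hermitian_mats k) L"
    unfolding affine_subspace_def
  proof (intro conjI ballI allI impI)
    show "L \<subseteq> hermitian_mats k" by (auto simp: L_def)
    fix A B and a b :: real assume A: "A \<in> L" and B: "B \<in> L" and ab: "a + b = 1"
    obtain y where y: "\<And>m. y (m + int N) = y m" "y 0 = 1" "\<And>s t. s < k \<Longrightarrow> t < k \<Longrightarrow> A $$ (s, t) = y (\<phi> s - \<phi> t)"
      using A unfolding L_def by auto
    obtain y' where y': "\<And>m. y' (m + int N) = y' m" "y' 0 = 1" "\<And>s t. s < k \<Longrightarrow> t < k \<Longrightarrow> B $$ (s, t) = y' (\<phi> s - \<phi> t)"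
      using B unfolding L_def by auto
    have carr: "A \<in> carrier_mat k k" "B \<in> carrier_mat k k"
      using A B by (auto simp: L_def hermitian_mats_def)
    have herm: "C $$ (t, s) = cnj (C $$ (s, t))" if "C \<in> L" "s < k" "t < k" for C s t
    proof -
      have "C \<in> hermitian_mats k" using that(1) by (simp add: L_def)
      then show ?thesis using that(2,3) unfolding hermitian_mats_iff by blast
    qed
    have "real_smult_mat a A + real_smult_mat b B \<in> hermitian_mats k"
      unfolding hermitian_mats_iff
    proof (intro conjI allI impI)
      fix s t assume "s < k" "t < k"
      then show "(real_smult_mat a A + real_smult_mat b B) $$ (t, s) =
          cnj ((real_smult_mat a A + real_smult_mat b B) $$ (s, t))"
        using carr herm[OF A, of s t] herm[OF B, of s t] by simp
    qed (use carr in simp)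
    moreover have "complex_of_real a + complex_of_real b = 1"
      using ab by (metis of_real_1 of_real_add)
    ultimately show "real_smult_mat a A + real_smult_mat b B \<in> L"
      unfolding L_def using carr y y' by (auto intro!: exI[of _ "\<lambda>m. of_real a * y m + of_real b * y' m"])
  qed
  moreover have "trig_cyclic_polytope d N = f ` (psd_cone k \<inter> L)"
  proof (intro equalityI subsetI)
    fix p assume "p \<in> trig_cyclic_polytope d N"
    then obtain c where c: "\<And>x. x < N \<Longrightarrow> 0 \<le> c x" "(\<Sum>x<N. c x) = 1"
      and p: "p = vec (2 * d) (\<lambda>i. \<Sum>x<N. c x * trig_vertex d N x $ i)"
      unfolding trig_cyclic_polytope_eq[OF d] by blast
    define y where "y m = (\<Sum>x<N. of_real (c x) * root_char N x m)" for m
    define A where "A = mat k k (\<lambda>(s, t). y (\<phi> s - \<phi> t))"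
    have A: "A \<in> carrier_mat k k" "\<And>s t. s < k \<Longrightarrow> t < k \<Longrightarrow> A $$ (s, t) = y (\<phi> s - \<phi> t)"
      by (simp_all add: A_def)
    have "psd_kernel {..<k} (\<lambda>s t. A $$ (s, t))"
      by (rule psd_kernel_cong[OF psd_kernel_moments[of N c _ \<phi>]]) (use c A y_def in auto)
    then have psd: "A \<in> psd_cone k"
      using A by (simp add: psd_cone_iff)
    have "y 0 = of_real (\<Sum>x<N. c x)" by (simp add: y_def)
    then have "y 0 = 1" using c(2) by simp
    moreover have "y (m + int N) = y m" for m
      by (simp add: y_def root_char_period[OF N])
    ultimately have "A \<in> L"
      using psd A(2) unfolding L_def psd_cone_def by blast
    moreover have "p = f A"
      unfolding p f_def using dk d
      by (auto simp: A \<phi> y_def trig_vertex_def intro!: eq_vecI)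
    ultimately show "p \<in> f ` (psd_cone k \<inter> L)" using psd by blast
  next
    fix p assume "p \<in> f ` (psd_cone k \<inter> L)"
    then obtain A where A: "A \<in> psd_cone k" "A \<in> L" and p: "p = f A" by blast
    then obtain y where y: "\<And>m. y (m + int N) = y m" "y 0 = 1"
      "\<And>s t. s < k \<Longrightarrow> t < k \<Longrightarrow> A $$ (s, t) = y (\<phi> s - \<phi> t)"
      unfolding L_def by auto
    define S where "S = \<phi> ` {..<k}"
    have S0: "{0..<int d} \<subseteq> S"
    proof
      fix u assume u: "u \<in> {0..<int d}"
      then have "u = \<phi> (nat u)" "nat u < k" using dk \<phi>[of "nat u"] by auto
      then show "u \<in> S" unfolding S_def by blast
    qed
    have S1: "{int d * 2 ^ q..<int d * 2 ^ q + int d} \<subseteq> S" if "q \<le> n" for q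
      using sparse_freq_block[OF d that] by (simp add: S_def \<phi>_def k_def)
    \<comment> \<open>Choosing an index for each frequency turns the matrix into a kernel on a set
      of integers, as completion requires.\<close>
    have g: "inv_into {..<k} \<phi> u < k" "\<phi> (inv_into {..<k} \<phi> u) = u" if "u \<in> S" for u
      using that inv_into_into[of u \<phi> "{..<k}"] f_inv_into_f[of u \<phi> "{..<k}"] by (auto simp: S_def)
    have "psd_kernel {..<k} (\<lambda>s t. A $$ (s, t))"
      using A by (simp add: psd_cone_iff)
    then have "psd_kernel S (\<lambda>u v. A $$ (inv_into {..<k} \<phi> u, inv_into {..<k} \<phi> v))"
      by (rule psd_kernel_map) (use g in auto)
    then have psd: "psd_kernel S (\<lambda>u v. y (u - v))"
      by (rule psd_kernel_cong) (use g y(3) in auto)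
    obtain \<mu> where \<mu>: "\<And>x. 0 \<le> \<mu> x"
      "\<And>m. m \<le> d \<Longrightarrow> (\<Sum>x<N. of_real (\<mu> x) * root_char N x (int m)) = y (int m)"
      using toeplitz_moments[OF d _ psd S0 S1, of n] y(1) unfolding N_def S_def by auto
    have "complex_of_real (\<Sum>x<N. \<mu> x) = 1"
      using \<mu>(2)[of 0] y(2) by simp
    then have "(\<Sum>x<N. \<mu> x) = 1" by (simp only: of_real_eq_1_iff)
    moreover have "p = vec (2 * d) (\<lambda>i. \<Sum>x<N. \<mu> x * trig_vertex d N x $ i)"
    proof (rule eq_vecI)
      fix i assume "i < dim_vec (vec (2 * d) (\<lambda>i. \<Sum>x<N. \<mu> x * trig_vertex d N x $ i))"
      then have i: "i < 2 * d" by simp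
      show "p $ i = vec (2 * d) (\<lambda>i. \<Sum>x<N. \<mu> x * trig_vertex d N x $ i) $ i"
      proof (cases "i < d")
        case True
        then have "p $ i = Re (y (int (i + 1)))"
          using i dk y(3)[of "i + 1" 0] \<phi>[of "i + 1"] \<phi>[of 0] by (simp add: p f_def)
        then show ?thesis
          using i True \<mu>(2)[of "i + 1", symmetric] by (simp add: trig_vertex_def)
      next
        case False
        then have "p $ i = Im (y (int (i - d + 1)))"
          using i dk y(3)[of "i - d + 1" 0] \<phi>[of "i - d + 1"] \<phi>[of 0] by (simp add: p f_def)
        then show ?thesis
          using i False \<mu>(2)[of "i - d + 1", symmetric] by (simp add: trig_vertex_def)
      qed
    qed (simp add: p f_def)
    ultimately show "p \<in> trig_cyclic_polytope d N"
      unfolding trig_cyclic_polytope_eq[OF d] using \<mu>(1) by blast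
  qed
  ultimately show ?thesis
    unfolding has_psd_lift_def has_cone_lift_def N_def k_def by blast
qed

section \<open>Trigonometric polynomials and neighborliness\<close>

lemma sum_split_double: "(\<Sum>i<d + e. f i) = (\<Sum>i<d. f i) + (\<Sum>i<e. f (d + i))" for f :: "nat \<Rightarrow> 'a::comm_monoid_add"
  by (induction e) (simp_all add: add.assoc)

lemma affine_functional_coord:
  "affine_functional m (\<lambda>p. b + (\<Sum>i<m. a i * p $ i))"
  unfolding affine_functional_def
proof (intro ballI allI impI)
  fix p q :: "real vec" and s t :: real
  assume pq: "p \<in> carrier_vec m" "q \<in> carrier_vec m" and st: "s + t = 1"
  have "(\<Sum>i<m. a i * (s \<cdot>\<^sub>v p + t \<cdot>\<^sub>v q) $ i) = s * (\<Sum>i<m. a i * p $ i) + t * (\<Sum>i<m. a i * q $ i)"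
    using pq by (simp add: algebra_simps sum.distrib sum_distrib_left)
  moreover have "b = s * b + t * b" using st by (metis distrib_right mult_1)
  ultimately show "b + (\<Sum>i<m. a i * (s \<cdot>\<^sub>v p + t \<cdot>\<^sub>v q) $ i) =
      s * (b + (\<Sum>i<m. a i * p $ i)) + t * (b + (\<Sum>i<m. a i * q $ i))"
    by (simp add: algebra_simps)
qed

text \<open>Real trigonometric polynomials of degree at most \<open>D\<close>. Negative frequencies
  are conjugates of positive ones on the circle, so real parts of ordinary polynomials
  suffice.\<close>

definition trig_poly :: "nat \<Rightarrow> (complex \<Rightarrow> real) \<Rightarrow> bool" where
  "trig_poly D g \<longleftrightarrow> (\<exists>c. \<forall>z. norm z = 1 \<longrightarrow> g z = Re (\<Sum>m\<le>D. c m * z ^ m))"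

lemma trig_poly_sum:
  assumes "\<And>i. i \<in> A \<Longrightarrow> trig_poly D (g i)"
  shows "trig_poly D (\<lambda>z. \<Sum>i\<in>A. g i z)"
proof -
  obtain c where c: "\<And>i z. i \<in> A \<Longrightarrow> norm z = 1 \<Longrightarrow> g i z = Re (\<Sum>m\<le>D. c i m * z ^ m)"
    using assms unfolding trig_poly_def by metis
  have "(\<Sum>i\<in>A. g i z) = Re (\<Sum>m\<le>D. (\<Sum>i\<in>A. c i m) * z ^ m)" if "norm z = 1" for z
  proof -
    have "(\<Sum>i\<in>A. g i z) = Re (\<Sum>i\<in>A. \<Sum>m\<le>D. c i m * z ^ m)"
      using c that by simp
    also have "(\<Sum>i\<in>A. \<Sum>m\<le>D. c i m * z ^ m) = (\<Sum>m\<le>D. \<Sum>i\<in>A. c i m * z ^ m)"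
      by (rule sum.swap)
    finally show ?thesis by (simp only: sum_distrib_right)
  qed
  then show ?thesis
    unfolding trig_poly_def by (intro exI[of _ "\<lambda>m. \<Sum>i\<in>A. c i m"] allI impI)
qed

lemma power_mult_cnj_power:
  assumes "norm z = 1" "j \<le> i"
  shows "z ^ i * cnj z ^ j = z ^ (i - j)"
proof -
  have "z * cnj z = 1" using assms(1) complex_norm_square[of z] by simp
  then have "z ^ j * cnj z ^ j = 1" by (metis power_mult_distrib power_one)
  then show ?thesis
    using power_add[of z "i - j" j] assms(2) by (simp add: mult.assoc)
qed

lemma trig_poly_monom:
  assumes "i \<le> D" "j \<le> D"
  shows "trig_poly D (\<lambda>z. Re (a * z ^ i * cnj z ^ j))"
proof -
  define e where "e = (if j \<le> i then i - j else j - i)"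
  \<comment> \<open>A negative exponent \<open>i - j\<close> is removed by conjugating the whole
    monomial, which preserves the real part.\<close>
  define b where "b = (if j \<le> i then a else cnj a)"
  have "Re (a * z ^ i * cnj z ^ j) = Re (\<Sum>m\<le>D. (if m = e then b else 0) * z ^ m)" if "norm z = 1" for z
  proof -
    have "e \<le> D" unfolding e_def using assms by (cases "j \<le> i") auto
    have "(\<Sum>m\<le>D. (if m = e then b else 0) * z ^ m) = (\<Sum>m\<le>D. if m = e then b * z ^ m else 0)"
      by (intro sum.cong) auto
    also have "\<dots> = b * z ^ e"
      using \<open>e \<le> D\<close> by simp
    finally have *: "(\<Sum>m\<le>D. (if m = e then b else 0) * z ^ m) = b * z ^ e" .
    show ?thesis
    proof (cases "j \<le> i")
      case True
      then show ?thesis unfolding * using power_mult_cnj_power[OF that True]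
        by (simp add: b_def e_def mult.assoc)
    next
      case False
      then have "a * z ^ i * cnj z ^ j = cnj (b * z ^ e)"
        using power_mult_cnj_power[of "cnj z" i j] that by (simp add: b_def e_def mult_ac)
      then show ?thesis unfolding * by (metis complex_cnj(1) cnj.simps(1))
    qed
  qed
  then show ?thesis
    unfolding trig_poly_def by (intro exI[of _ "\<lambda>m. if m = e then b else 0"] allI impI)
qed

text \<open>Squaring does not double the degree: in the product with the conjugate the exponents
  subtract.\<close>

lemma trig_poly_norm_square:
  assumes "degree p \<le> D"
  shows "trig_poly D (\<lambda>z. (norm (poly p z))\<^sup>2)"
proof -
  have "(norm (poly p z))\<^sup>2 = (\<Sum>i\<le>degree p. \<Sum>j\<le>degree p. Re (coeff p i * cnj (coeff p j) * z ^ i * cnj z ^ j))" for z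
  proof -
    have "of_real ((norm (poly p z))\<^sup>2) = poly p z * cnj (poly p z)"
      by (rule complex_norm_square)
    also have "\<dots> = (\<Sum>i\<le>degree p. \<Sum>j\<le>degree p. coeff p i * cnj (coeff p j) * z ^ i * cnj z ^ j)"
      by (simp add: poly_altdef sum_product mult_ac)
    finally have "Re (of_real ((norm (poly p z))\<^sup>2)) = Re (\<Sum>i\<le>degree p. \<Sum>j\<le>degree p. coeff p i * cnj (coeff p j) * z ^ i * cnj z ^ j)"
      by (rule arg_cong)
    then show ?thesis by (simp only: Re_complex_of_real Re_sum)
  qed
  then show ?thesis
    using assms by (simp only:) (intro trig_poly_sum trig_poly_monom; simp)
qed

lemma trig_poly_affine:
  assumes "trig_poly d g"
  obtains a b where "\<And>x. g (root_char N x 1) = b + (\<Sum>i<2 * d. a i * trig_vertex d N x $ i)"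
proof -
  obtain c where c: "\<And>z. norm z = 1 \<Longrightarrow> g z = Re (\<Sum>m\<le>d. c m * z ^ m)"
    using assms unfolding trig_poly_def by blast
  \<comment> \<open>The sign comes from
    \<open>Re (c * z) = Re c * Re z - Im c * Im z\<close>.\<close>
  define a where "a i = (if i < d then Re (c (i + 1)) else - Im (c (i - d + 1)))" for i
  have "g (root_char N x 1) = Re (c 0) + (\<Sum>i<2 * d. a i * trig_vertex d N x $ i)" for x
  proof -
    have "(\<Sum>m\<le>d. c m * root_char N x 1 ^ m) = c 0 + (\<Sum>i<d. c (i + 1) * root_char N x (int (i + 1)))"
      unfolding lessThan_Suc_atMost[symmetric] sum.lessThan_Suc_shift
      by (simp only: root_char_nat power_0 mult_1_right Suc_eq_plus1)
    then have "g (root_char N x 1) = Re (c 0) + Re (\<Sum>i<d. c (i + 1) * root_char N x (int (i + 1)))"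
      using c[of "root_char N x 1"] by simp
    also have "Re (\<Sum>i<d. c (i + 1) * root_char N x (int (i + 1))) =
      (\<Sum>i<d. Re (c (i + 1)) * Re (root_char N x (int (i + 1)))) +
      (\<Sum>i<d. - Im (c (i + 1)) * Im (root_char N x (int (i + 1))))"
      by (simp add: sum_subtractf sum_negf)
    also have "\<dots> = (\<Sum>i<d + d. a i * trig_vertex d N x $ i)"
      unfolding sum_split_double by (simp add: a_def trig_vertex_def)
    finally show ?thesis by (simp add: mult_2)
  qed
  then show ?thesis using that by blast
qed

text \<open>The squared norm of the polynomial with simple roots at \<open>F\<close> has degree at
  most \<open>d\<close>, so it is affine in the vertex coordinates.\<close>

lemma trig_cyclic_polytope_neighborly:
  assumes d: "d > 0" and F: "F \<subseteq> {..<N}" "card F \<le> d"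
  shows "\<exists>l. affine_functional (2 * d) l \<and> (\<forall>p\<in>trig_cyclic_polytope d N. 0 \<le> l p) \<and>
    (\<forall>x\<in>F. l (trig_vertex d N x) = 0) \<and> (\<forall>x\<in>{..<N} - F. 0 < l (trig_vertex d N x))"
proof -
  have fF: "finite F" using F finite_subset by blast
  define q where "q = (\<Prod>w\<in>F. [:- root_char N w 1, 1:])"
  have "degree q \<le> (\<Sum>w\<in>F. degree [:- root_char N w 1, 1:])"
    unfolding q_def using degree_prod_sum_le[OF fF, of "\<lambda>w. [:- root_char N w 1, 1:]"] by (simp add: o_def)
  also have "\<dots> \<le> d" using F by simp
  finally have "trig_poly d (\<lambda>z. (norm (poly q z))\<^sup>2)"
    by (rule trig_poly_norm_square)
  then obtain a b where ab: "\<And>x. (norm (poly q (root_char N x 1)))\<^sup>2 = b + (\<Sum>i<2 * d. a i * trig_vertex d N x $ i)"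
    using trig_poly_affine[where N = N] by blast
  define l where "l p = b + (\<Sum>i<2 * d. a i * p $ i)" for p :: "real vec"
  have l: "l (trig_vertex d N x) = (norm (poly q (root_char N x 1)))\<^sup>2" for x
    unfolding l_def ab ..
  have q0: "poly q (root_char N x 1) = 0 \<longleftrightarrow> x \<in> F" if "x < N" for x
    unfolding q_def poly_prod using fF F that root_char_inj[of x N] by (auto simp: prod_zero_iff)
  have "0 \<le> l p" if "p \<in> trig_cyclic_polytope d N" for p
  proof -
    obtain c where c: "\<And>x. x < N \<Longrightarrow> 0 \<le> c x" "(\<Sum>x<N. c x) = 1"
      and p: "p = vec (2 * d) (\<lambda>i. \<Sum>x<N. c x * trig_vertex d N x $ i)"
      using \<open>p \<in> _\<close> unfolding trig_cyclic_polytope_eq[OF d] by blast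
    have "l p = b * (\<Sum>x<N. c x) + (\<Sum>i<2 * d. \<Sum>x<N. a i * (c x * trig_vertex d N x $ i))"
      unfolding l_def p c(2) by (simp add: sum_distrib_left)
    also have "(\<Sum>i<2 * d. \<Sum>x<N. a i * (c x * trig_vertex d N x $ i)) = (\<Sum>x<N. \<Sum>i<2 * d. a i * (c x * trig_vertex d N x $ i))"
      by (rule sum.swap)
    also have "b * (\<Sum>x<N. c x) + \<dots> = (\<Sum>x<N. c x * l (trig_vertex d N x))"
      by (simp add: l_def sum_distrib_left algebra_simps sum.distrib)
    also have "\<dots> \<ge> 0" unfolding l using c by (intro sum_nonneg) simp
    finally show ?thesis .
  qed
  moreover have "affine_functional (2 * d) l"
    unfolding l_def by (rule affine_functional_coord)
  ultimately show ?thesis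
    using F q0 by (intro exI[of _ l]) (auto simp: l)
qed

lemma trig_vertex_in_trig_cyclic_polytope:
  assumes "d > 0" "x < N"
  shows "trig_vertex d N x \<in> trig_cyclic_polytope d N"
proof -
  have "trig_vertex d N x = vec (2 * d) (\<lambda>i. \<Sum>w<N. (if w = x then 1 else 0) * trig_vertex d N w $ i)"
  proof (rule eq_vecI)
    fix i assume "i < dim_vec (vec (2 * d) (\<lambda>i. \<Sum>w<N. (if w = x then 1 else 0) * trig_vertex d N w $ i))"
    moreover have "(\<Sum>w<N. (if w = x then 1 else 0) * trig_vertex d N w $ i) = (\<Sum>w<N. if w = x then trig_vertex d N w $ i else 0)"
      by (intro sum.cong) auto
    ultimately show "trig_vertex d N x $ i = vec (2 * d) (\<lambda>i. \<Sum>w<N. (if w = x then 1 else 0) * trig_vertex d N w $ i) $ i"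
      using assms(2) by simp
  qed (simp add: trig_vertex_def)
  moreover have "(\<Sum>w<N. if w = x then 1 else 0) = (1::real)" using assms(2) by simp
  ultimately show ?thesis
    unfolding trig_cyclic_polytope_eq[OF assms(1)]
    by (intro CollectI exI[of _ "\<lambda>w. if w = x then 1 else 0"]) auto
qed

section \<open>The ratio of the extension complexities\<close>

lemma xc_lp_trig_cyclic_polytope:
  assumes d: "d > 0" and N: "N \<ge> 2"
  shows "min (2 * N) ((d + 1) * (d + 2)) \<le> 2 * xc_lp (2 * d) (trig_cyclic_polytope d N)"
proof -
  let ?P = "trig_cyclic_polytope d N"
  have "has_lp_lift (2 * d) ?P N"
    unfolding trig_cyclic_polytope_eq[OF d] by (rule has_lp_lift_convex_hull)
  then have "0 < N \<and> has_lp_lift (2 * d) ?P N" using N by simp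
  then have "has_lp_lift (2 * d) ?P (xc_lp (2 * d) ?P)"
    unfolding xc_lp_def by (metis (mono_tags, lifting) LeastI)
  then have "min (2 * card {..<N}) ((d + 1) * (d + 2)) \<le> 2 * xc_lp (2 * d) ?P"
    by (rule lp_lift_lower_bound[where v = "trig_vertex d N"])
       (use d N trig_vertex_in_trig_cyclic_polytope trig_cyclic_polytope_neighborly in auto)
  then show ?thesis by simp
qed

lemma polytope_vec_trig_cyclic_polytope: "polytope_vec (2 * d) (trig_cyclic_polytope d N)"
  unfolding polytope_vec_def trig_cyclic_polytope_def
  by (intro exI[of _ "trig_vertex d N ` {..<N}"]) (auto simp: trig_vertex_def)

theorem corollary1:
  shows "\<exists>P :: nat \<Rightarrow> real vec set.
    (\<forall>d. polytope_vec (2 * d) (P d)) \<and>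
    (\<lambda>d. real (xc_psd (2 * d) (P d)) / real (xc_lp (2 * d) (P d)))
      \<in> O(\<lambda>d. ln (real d) / real d)"
proof (intro exI conjI allI)
  \<comment> \<open>This choice gives \<open>d \<le> 2 ^ n d\<close>, so there are at least
    \<open>d^2\<close> vertices, while the PSD lift has size of order
    \<open>d * log d\<close>.\<close>
  define n where "n d = nat \<lceil>log 2 (real d)\<rceil>" for d :: nat
  define P where "P d = trig_cyclic_polytope d (d * 2 ^ n d)" for d
  show "polytope_vec (2 * d) (P d)" for d
    unfolding P_def by (rule polytope_vec_trig_cyclic_polytope)
  \<comment> \<open>The constant is \<open>4 / (1/2)\<close>, from \<open>xc_psd\<close> at most
    \<open>4 * d * log 2 d\<close> and \<open>xc_lp\<close> at least \<open>d^2 / 2\<close>, with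
    \<open>1 / ln 2\<close> from the change of base.\<close>
  have bound: "real (xc_psd (2 * d) (P d)) / real (xc_lp (2 * d) (P d)) \<le> 8 / ln 2 * (ln (real d) / real d)"
    if d: "d \<ge> 2" for d
  proof -
    have log1: "1 \<le> log 2 (real d)" using d by simp
    have n_le: "real (n d) \<le> log 2 (real d) + 1"
      unfolding n_def using log1 by linarith
    have "log 2 (real d) \<le> real (n d)"
      unfolding n_def using log1 by linarith
    then have "2 powr log 2 (real d) \<le> 2 powr real (n d)" by simp
    then have "real d \<le> 2 ^ n d" using d by (simp add: powr_realpow)
    then have n_ge: "d \<le> 2 ^ n d" by (metis of_nat_le_iff of_nat_numeral of_nat_power)
    have "xc_psd (2 * d) (P d) \<le> d * (n d + 2)"
      unfolding xc_psd_def P_def using d has_psd_lift_trig_cyclic_polytope[of d "n d"]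
      by (intro Least_le) simp
    then have "real (xc_psd (2 * d) (P d)) \<le> real d * (real (n d) + 2)"
      by (metis of_nat_add of_nat_le_iff of_nat_mult of_nat_numeral)
    \<comment> \<open>\<open>n d + 2\<close> is at most \<open>log 2 d + 3\<close>, and
      \<open>log 2 d\<close> is at least \<open>1\<close> for \<open>d \<ge> 2\<close>.\<close>
    also have "\<dots> \<le> real d * (4 * log 2 (real d))"
      using n_le log1 by (intro mult_left_mono) auto
    finally have psd: "real (xc_psd (2 * d) (P d)) \<le> real d * (4 * log 2 (real d))" .
    have dd: "d * d \<le> d * 2 ^ n d" using n_ge by simp
    have "2 \<le> d * d" using d mult_le_mono[OF d d] by simp
    with dd have "2 \<le> d * 2 ^ n d" by (rule order_trans[rotated])
    then have "min (2 * (d * 2 ^ n d)) ((d + 1) * (d + 2)) \<le> 2 * xc_lp (2 * d) (P d)"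
      unfolding P_def using d by (intro xc_lp_trig_cyclic_polytope) auto
    moreover have "d * d \<le> min (2 * (d * 2 ^ n d)) ((d + 1) * (d + 2))"
    proof (rule min.boundedI)
      show "d * d \<le> 2 * (d * 2 ^ n d)" using dd by linarith
    qed simp
    ultimately have "d * d \<le> 2 * xc_lp (2 * d) (P d)" by (rule order_trans[rotated])
    then have "real (d * d) \<le> real (2 * xc_lp (2 * d) (P d))" by (rule of_nat_mono)
    then have lp: "real d * real d / 2 \<le> real (xc_lp (2 * d) (P d))" by simp
    have "real (xc_psd (2 * d) (P d)) / real (xc_lp (2 * d) (P d)) \<le>
      real d * (4 * log 2 (real d)) / (real d * real d / 2)"
      using psd lp d by (intro frac_le) auto
    also have "\<dots> = 8 / ln 2 * (ln (real d) / real d)"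
      using d by (simp add: log_def field_simps)
    finally show ?thesis .
  qed
  show "(\<lambda>d. real (xc_psd (2 * d) (P d)) / real (xc_lp (2 * d) (P d))) \<in> O(\<lambda>d. ln (real d) / real d)"
  proof (rule bigoI[where c = "8 / ln 2"])
    show "\<forall>\<^sub>F d in sequentially. norm (real (xc_psd (2 * d) (P d)) / real (xc_lp (2 * d) (P d)))
        \<le> 8 / ln 2 * norm (ln (real d) / real d)"
      using eventually_ge_at_top[of 2]
    proof eventually_elim
      case (elim d)
      then show ?case using bound[OF elim] by simp
    qed
  qed
qed

end
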